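(* Let $c_n$ ($n\ge3$) be the number of optimal strategies for Player I in the Penney-Ante game with strings of length $n$, and let $\alpha=\lim_{n\to\infty}c_n/2^n$ (this limit exists and is positive). Then $$\alpha=\frac1{16}-2\sum_{n=4}^\infty\frac{c_n}{4^n}.$$
   Context: Penney-Ante game with strings of length $n\ge3$: Player I chooses a string $A\in\{H,T\}^n$; Player II, seeing $A$, chooses $B\in\{H,T\}^n$, $B\ne A$. A fair coin is tossed repeatedly (independently) and the player whose string first appears as a block of consecutive tosses wins. A string $A$ is an optimal strategy for Player I if it maximizes $\min_{B\ne A}P(A\text{ appears before }B)$ over all $A\in\{H,T\}^n$. $c_n$ is the number of such optimal strings. *)

theory Defs
  imports "HOL-Probability.Probability"
begin

datatype coin = Heads | Tails

definition strings :: "nat \<Rightarrow> coin list set" where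
  "strings n = {A. length A = n}"

definition coin_tosses :: "coin stream measure" where
  "coin_tosses = stream_space (measure_pmf (pmf_of_set {Heads, Tails}))"

definition occurs_at :: "coin list \<Rightarrow> coin stream \<Rightarrow> nat \<Rightarrow> bool" where
  "occurs_at A \<omega> k \<longleftrightarrow> stake (length A) (sdrop k \<omega>) = A"

(* Positions are starting positions of the block; for strings of equal length,
   the string that starts first is the one that is completed first. *)
definition appears_before :: "coin list \<Rightarrow> coin list \<Rightarrow> coin stream \<Rightarrow> bool" where
  "appears_before A B \<omega> \<longleftrightarrow> (\<exists>k. occurs_at A \<omega> k \<and> (\<forall>j\<le>k. \<not> occurs_at B \<omega> j))"

definition win_prob :: "coin list \<Rightarrow> coin list \<Rightarrow> real" where
  "win_prob A B = measure coin_tosses {\<omega> \<in> space coin_tosses. appears_before A B \<omega>}"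

definition guaranteed_prob :: "nat \<Rightarrow> coin list \<Rightarrow> real" where
  "guaranteed_prob n A = Min (win_prob A ` (strings n - {A}))"

definition optimal_strategy :: "nat \<Rightarrow> coin list \<Rightarrow> bool" where
  "optimal_strategy n A \<longleftrightarrow>
     A \<in> strings n \<and> (\<forall>A'\<in>strings n. guaranteed_prob n A' \<le> guaranteed_prob n A)"

definition num_optimal :: "nat \<Rightarrow> nat" where
  "num_optimal n = card {A. optimal_strategy n A}"

lemma UNIV_coin: "UNIV = {Heads, Tails}"
  using coin.exhaust by auto

lemma finite_strings: "finite (strings n)"
  unfolding strings_def
  using finite_lists_length_eq[of "UNIV :: coin set" n] by (simp add: UNIV_coin) (simp flip: UNIV_coin)

lemma prob_space_coin_tosses: "prob_space coin_tosses"
  unfolding coin_tosses_def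
  by (intro prob_space.prob_space_stream_space measure_pmf.prob_space_axioms)

lemma sets_appears_before:
  "{\<omega> \<in> space coin_tosses. appears_before A B \<omega>} \<in> sets coin_tosses"
proof -
  have snth: "(\<lambda>\<omega>. \<omega> !! i) \<in> coin_tosses \<rightarrow>\<^sub>M count_space UNIV" for i
    unfolding coin_tosses_def
    using measurable_snth[of i "measure_pmf (pmf_of_set {Heads, Tails})"] by simp
  have eq: "occurs_at C \<omega> k \<longleftrightarrow> (\<forall>i\<in>{..<length C}. \<omega> !! (k + i) = C ! i)" for C \<omega> k
    unfolding occurs_at_def by (auto simp: list_eq_iff_nth_eq sdrop_snth add.commute)
  have [measurable]: "Measurable.pred coin_tosses (\<lambda>\<omega>. occurs_at C \<omega> k)" for C k
    unfolding eq using snth by measurable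
  show ?thesis
    unfolding appears_before_def by measurable
qed

end

theory Submission
  imports Defs "HOL-Library.Sublist"
begin

text \<open>
  Write \<open>XY\<close> for the sum of \<open>2^(k-1)\<close> over all \<open>k\<close> such that the last \<open>k\<close> letters of \<open>X\<close> are the
  first \<open>k\<close> letters of \<open>Y\<close>. A word avoiding \<open>A\<close> and \<open>B\<close> acquires its first hit while \<open>A\<close> is being
  appended to it; counting by the position of that hit gives Conway's odds
  \<open>BB - BA : AA - AB\<close> for \<open>A\<close> to appear before \<open>B\<close>.

  Let \<open>x = 2^(n-2)\<close> and \<open>A'\<close> be \<open>A\<close> without its last letter. For a reply \<open>B = bA'\<close> these odds are
  \<open>x + u_b : 2x - v_b\<close>, where \<open>u\<close> and \<open>v\<close> are determined by the letters that precede the borders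
  of \<open>A'\<close> and \<open>A\<close>, and each of \<open>u\<close>, \<open>v\<close> sums to 1 over the two choices of \<open>b\<close>. A border preceded by a
  letter other than the first letter of the word is never followed by a border that is longer by
  one. Hence some reply pushes the odds below \<open>x + 1 : 2x + 1\<close>, unless \<open>A = Va\<close> with \<open>V\<close> of the
  form \<open>a a' \<dots> a' a\<close> (\<open>a'\<close> the other letter) and no border of \<open>V\<close> but \<open>a\<close>. Against such an \<open>A\<close> no
  \<open>B\<close> does better, because \<open>BA < x\<close> if \<open>B\<close> is not of the form \<open>bV\<close>.

  Inserting one or two letters into the middle of such a word \<open>V\<close> of length \<open>2m\<close> can create no
  border other than one of length \<open>m + 1\<close>, which is then itself such a word. This gives
  \<open>c(2m+2) = 2c(2m+1) - c(m+2)\<close> and \<open>c(2m+3) = 4c(2m+1) - c(m+2)\<close>, so \<open>c(2m+1) / 2^(2m+1)\<close>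
  telescopes.
\<close>

section \<open>Conway's formula\<close>

definition overlaps :: "'a list \<Rightarrow> 'a list \<Rightarrow> nat set" where
  "overlaps X Y = {k. 0 < k \<and> k \<le> length X \<and> drop (length X - k) X = take k Y}"

definition weight :: "nat set \<Rightarrow> int" where
  "weight S = (\<Sum>k\<in>S. 2 ^ (k - 1))"

definition corr :: "'a list \<Rightarrow> 'a list \<Rightarrow> int" where
  "corr X Y = weight (overlaps X Y)"

definition avoids :: "'a list set \<Rightarrow> 'a list \<Rightarrow> bool" where
  "avoids C w \<longleftrightarrow> (\<forall>X\<in>C. \<not> sublist X w)"

definition avoiding :: "'a list set \<Rightarrow> nat \<Rightarrow> 'a list set" where
  "avoiding C m = {w. length w = m \<and> avoids C w}"

text \<open>Avoidance is asked of \<open>butlast w\<close> only: no member of \<open>C\<close> is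
  completed before the last letter of \<open>w\<close>, at which \<open>X\<close> is.\<close>

definition hits :: "'a list set \<Rightarrow> 'a list \<Rightarrow> nat \<Rightarrow> 'a list set" where
  "hits C X m = {w. length w = m \<and> suffix X w \<and> avoids C (butlast w)}"

lemma finite_overlaps [simp]: "finite (overlaps X Y)"
  unfolding overlaps_def by (rule finite_subset[of _ "{..length X}"]) auto

lemma avoids_sublist: "avoids C w \<Longrightarrow> sublist v w \<Longrightarrow> avoids C v"
  unfolding avoids_def by (meson sublist_order.order_trans)

lemma avoids_snoc:
  "avoids C (w @ [c]) \<longleftrightarrow> avoids C w \<and> (\<forall>X\<in>C. \<not> suffix X (w @ [c]))"
  unfolding avoids_def by (auto simp: sublist_snoc)

lemma suffix_length_unique:
  "suffix X w \<Longrightarrow> suffix Y w \<Longrightarrow> length X = length Y \<Longrightarrow> X = Y"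
  by (auto simp: suffix_def)

text \<open>The last \<open>k\<close> letters of \<open>w\<close> are the last \<open>k\<close>
  letters of \<open>X\<close>, which an overlap turns into the first \<open>k\<close> letters of
  \<open>Y\<close>. Hence \<open>w\<close> can be recovered from \<open>take m w\<close> and
  \<open>k\<close>.\<close>

lemma hits_overlap_decomp:
  assumes "w \<in> hits C X (m + k)" "k \<in> overlaps X Y"
  shows "w = take m w @ take k Y"
proof -
  from assms obtain u where u: "w = u @ X" and l: "length w = m + k"
    by (auto simp: hits_def suffix_def)
  have k: "k \<le> length X" "drop (length X - k) X = take k Y"
    using assms(2) by (auto simp: overlaps_def)
  have "drop m w = take k Y"
  proof -
    have "m - length u = length X - k" "length u \<le> m" using u l k by auto
    with u k show ?thesis by simp
  qed
  then show ?thesis by (metis append_take_drop_id)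
qed

lemma avoids_prefix_hits:
  assumes "w \<in> hits C X (m + k)" "0 < k" "m \<le> j" "j < m + k"
  shows "avoids C (take j w)"
proof -
  have "take j w = take j (butlast w)"
    using assms by (simp add: hits_def take_butlast)
  then show ?thesis
    using assms by (metis (no_types, lifting) avoids_sublist hits_def mem_Collect_eq sublist_take)
qed

text \<open>Appending \<open>Y\<close> to a word avoiding \<open>C\<close> completes some member of
  \<open>C\<close>. Stopping at the first completion, after \<open>k\<close> letters, produces
  \<open>w\<close>, and the end of that member is then the beginning of \<open>Y\<close>. Equal
  lengths make the completed member unique.\<close>

lemma bij_betw_hits_avoiding:
  assumes len: "\<And>X. X \<in> C \<Longrightarrow> length X = n" and Y: "Y \<in> C" and n: "0 < n"
  shows "bij_betw (\<lambda>(X, k, w). take m w)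
    (SIGMA X:C. SIGMA k:overlaps X Y. hits C X (m + k)) (avoiding C m)"
  unfolding bij_betw_def
proof (intro conjI)
  \<comment> \<open>If \<open>k'\<close> were smaller than \<open>k\<close>, then \<open>w'\<close>
    would be a proper prefix of \<open>w\<close>, and \<open>X'\<close> would be completed before
    the last letter of \<open>w\<close>.\<close>
  have k_le: "k \<le> k'" if "w \<in> hits C X (m + k)" "k \<in> overlaps X Y"
    "w' \<in> hits C X' (m + k')" "k' \<in> overlaps X' Y" "take m w = take m w'" "X' \<in> C"
    for w w' k k' X X'
  proof (rule ccontr)
    assume "\<not> k \<le> k'"
    then have lt: "k' < k" by simp
    have "w = take m w @ take k Y" "w' = take m w @ take k' Y"
      using hits_overlap_decomp that by metis+
    moreover have "m \<le> length w" using that by (simp add: hits_def)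
    ultimately have "w' = take (m + k') w"
      using lt by (auto simp: take_append dest!: arg_cong[of w _ "take (m + k')"])
    then have "avoids C w'"
      using avoids_prefix_hits[OF that(1), of "m + k'"] lt by simp
    moreover have "suffix X' w'" using that by (simp add: hits_def)
    ultimately show False using \<open>X' \<in> C\<close> by (auto simp: avoids_def)
  qed
  show "inj_on (\<lambda>(X, k, w). take m w)
    (SIGMA X:C. SIGMA k:overlaps X Y. hits C X (m + k))"
  proof (rule inj_onI)
    fix p q
    assume pq: "p \<in> (SIGMA X:C. SIGMA k:overlaps X Y. hits C X (m + k))"
      "q \<in> (SIGMA X:C. SIGMA k:overlaps X Y. hits C X (m + k))"
      "(case p of (X, k, w) \<Rightarrow> take m w) = (case q of (X, k, w) \<Rightarrow> take m w)"
    obtain X k w X' k' w' where eq: "p = (X, k, w)" "q = (X', k', w')"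
      by (cases p, cases q) auto
    with pq have *: "X \<in> C" "k \<in> overlaps X Y" "w \<in> hits C X (m + k)"
      "X' \<in> C" "k' \<in> overlaps X' Y" "w' \<in> hits C X' (m + k')" "take m w = take m w'"
      by auto
    have k: "k = k'" using k_le[of w X k w' X' k'] k_le[of w' X' k' w X k] * by auto
    have w: "w = w'" using hits_overlap_decomp * k by metis
    have "X = X'"
      using * w len by (auto simp: hits_def intro: suffix_length_unique)
    with k w eq show "p = q" by simp
  qed
  show "(\<lambda>(X, k, w). take m w) ` (SIGMA X:C. SIGMA k:overlaps X Y. hits C X (m + k))
    = avoiding C m" (is "?f ` ?S = _")
  proof (intro equalityI subsetI)
    fix v assume "v \<in> ?f ` ?S"
    then obtain X k w where *: "X \<in> C" "k \<in> overlaps X Y" "w \<in> hits C X (m + k)" "v = take m w"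
      by auto
    then show "v \<in> avoiding C m"
      using avoids_prefix_hits[OF *(3), of m]
      by (auto simp: avoiding_def overlaps_def hits_def)
  next
    fix v assume v: "v \<in> avoiding C m"
    define k where "k = (LEAST k. \<not> avoids C (v @ take k Y))"
    have ex: "\<not> avoids C (v @ take n Y)"
      using Y len by (auto simp: avoids_def)
    have nk: "\<not> avoids C (v @ take k Y)" unfolding k_def using ex by (rule LeastI)
    have kn: "k \<le> n" unfolding k_def using ex by (rule Least_le)
    have k0: "0 < k" using nk v by (cases k) (auto simp: avoiding_def)
    define w where "w = v @ take k Y"
    have lw: "length w = m + k" using v kn len[OF Y] by (simp add: w_def avoiding_def)
    have "avoids C (v @ take (k - 1) Y)"
      using not_less_Least[of "k - 1" "\<lambda>k. \<not> avoids C (v @ take k Y)"] k0 by (simp add: k_def)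
    moreover have bl: "butlast w = v @ take (k - 1) Y"
      using k0 kn len[OF Y] n unfolding w_def by (auto simp: butlast_append butlast_take)
    ultimately have av: "avoids C (butlast w)" by simp
    have wne: "w \<noteq> []" using lw k0 by auto
    then have "w = butlast w @ [last w]" by simp
    then obtain X where X: "X \<in> C" "suffix X w"
      using av nk avoids_snoc[of C "butlast w" "last w"] by (auto simp: w_def)
    have "drop (length X - k) X = take k Y"
    proof -
      obtain u where u: "w = u @ X" using X by (auto simp: suffix_def)
      have "drop m w = drop (length X - k) X"
      proof -
        have "m - length u = length X - k" "length u \<le> m" using u lw kn len[OF X(1)] by auto
        with u show ?thesis by simp
      qed
      moreover have "drop m w = take k Y" using v by (simp add: w_def avoiding_def)
      ultimately show ?thesis by simp
    qed
    then have "k \<in> overlaps X Y" using k0 kn len[OF X(1)] by (simp add: overlaps_def)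
    moreover have "w \<in> hits C X (m + k)" using lw X av by (simp add: hits_def)
    moreover have "v = take m w" using v by (simp add: w_def avoiding_def)
    ultimately show "v \<in> ?f ` ?S" using X by force
  qed
qed

lemma finite_coin_lists: "finite {w :: coin list. length w = m}"
  using finite_strings[of m] by (simp add: strings_def)

lemma finite_avoiding: "finite (avoiding C m :: coin list set)"
  by (rule finite_subset[OF _ finite_coin_lists[of m]]) (auto simp: avoiding_def)

lemma finite_hits: "finite (hits C X m :: coin list set)"
  by (rule finite_subset[OF _ finite_coin_lists[of m]]) (auto simp: hits_def)

lemma card_avoiding:
  fixes C :: "coin list set"
  assumes "finite C" "\<And>X. X \<in> C \<Longrightarrow> length X = n" "Y \<in> C" "0 < n"
  shows "card (avoiding C m) = (\<Sum>X\<in>C. \<Sum>k\<in>overlaps X Y. card (hits C X (m + k)))"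
  using bij_betw_same_card[OF bij_betw_hits_avoiding[OF assms(2-4), of m]] assms(1)
  by (simp add: card_SigmaI finite_hits)

text \<open>One letter appended to an avoiding word either keeps it avoiding or completes exactly
  one member of \<open>C\<close>, since members of equal length that end at the same place
  coincide.\<close>

lemma card_avoiding_Suc:
  fixes C :: "coin list set"
  assumes "finite C" "\<And>X. X \<in> C \<Longrightarrow> length X = n"
  shows "2 * card (avoiding C m) = card (avoiding C (Suc m)) + (\<Sum>X\<in>C. card (hits C X (Suc m)))"
proof -
  let ?S = "(\<lambda>(w, c). w @ [c]) ` (avoiding C m \<times> UNIV)"
  have "?S = {w. length w = Suc m \<and> avoids C (butlast w)}"
    by (auto simp: avoiding_def image_iff length_Suc_conv_rev)
  also have "\<dots> = avoiding C (Suc m) \<union> (\<Union>X\<in>C. hits C X (Suc m))"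
    by (auto simp: avoiding_def hits_def length_Suc_conv_rev avoids_snoc)
  finally have eq: "?S = avoiding C (Suc m) \<union> (\<Union>X\<in>C. hits C X (Suc m))" .
  have "card ?S = card (avoiding C m) * 2"
    by (subst card_image) (auto simp: inj_on_def card_cartesian_product UNIV_coin)
  moreover have "card (avoiding C (Suc m) \<union> (\<Union>X\<in>C. hits C X (Suc m))) =
      card (avoiding C (Suc m)) + card (\<Union>X\<in>C. hits C X (Suc m))"
  proof (rule card_Un_disjoint)
    show "avoiding C (Suc m) \<inter> (\<Union>X\<in>C. hits C X (Suc m)) = {}"
      by (auto simp: avoiding_def hits_def length_Suc_conv_rev avoids_snoc)
  qed (simp_all add: finite_avoiding finite_hits assms)
  moreover have "card (\<Union>X\<in>C. hits C X (Suc m)) = (\<Sum>X\<in>C. card (hits C X (Suc m)))"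
    by (rule card_UN_disjoint)
      (use assms finite_hits in \<open>auto, auto simp: hits_def dest: suffix_length_unique\<close>)
  ultimately show ?thesis using eq by simp
qed

section \<open>Hitting probabilities as series over the time of the first hit\<close>

definition hit_prob :: "coin list set \<Rightarrow> coin list \<Rightarrow> real" where
  "hit_prob C X = (\<Sum>m. card (hits C X m) / 2 ^ m)"

lemma hits_short: "m < length X \<Longrightarrow> hits C X m = {}"
  using suffix_length_le by (fastforce simp: hits_def)

text \<open>Both claims are counting identities divided by powers of 2: \<open>card_avoiding\<close>
  yields the series, with the factor 2 from \<open>2 ^ k = 2 * 2 ^ (k - 1)\<close>, and
  \<open>card_avoiding_Suc\<close> telescopes. The first sum is the expected number of tosses until
  the game ends, so it is the same for every \<open>Y\<close> in \<open>C\<close>.\<close>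

lemma
  fixes C :: "coin list set"
  assumes C: "finite C" "\<And>X. X \<in> C \<Longrightarrow> length X = n" "Y \<in> C" "0 < n"
  shows avoiding_sums:
      "(\<lambda>m. card (avoiding C m) / 2 ^ m) sums (2 * (\<Sum>X\<in>C. corr X Y * hit_prob C X))"
    and sum_hit_prob: "(\<Sum>X\<in>C. hit_prob C X) = 1"
proof -
  define p where "p X m = card (hits C X m) / 2 ^ m" for X m
  define s where "s m = card (avoiding C m) / 2 ^ m" for m
  have p0: "p X m = 0" if "X \<in> C" "m < n" for X m
    using that C(2) by (simp add: p_def hits_short)
  have p_nonneg: "0 \<le> p X m" for X m by (simp add: p_def)
  have s_nonneg: "0 \<le> s m" for m by (simp add: s_def)
  have s0: "s 0 = 1"
  proof -
    have "avoiding C 0 = {[]}" using C(2,4) by (force simp: avoiding_def avoids_def)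
    then show ?thesis by (simp add: s_def)
  qed
  have step: "s m = s (Suc m) + (\<Sum>X\<in>C. p X (Suc m))" for m
  proof -
    have "2 * real (card (avoiding C m)) =
        card (avoiding C (Suc m)) + (\<Sum>X\<in>C. real (card (hits C X (Suc m))))"
      using card_avoiding_Suc[OF C(1,2), of m, THEN arg_cong[of _ _ real]] by simp
    then show ?thesis
      by (simp add: s_def p_def field_simps flip: sum_divide_distrib)
  qed
  have partial: "(\<Sum>X\<in>C. \<Sum>j\<le>m. p X j) = 1 - s m" for m
  proof (induction m)
    case 0
    then show ?case using p0 C(4) s0 by simp
  next
    case (Suc m)
    then show ?case using step[of m] by (simp add: sum.distrib)
  qed
  have summ: "summable (p X)" if "X \<in> C" for X
  proof (rule bounded_imp_summable[where B = 1])
    show "(\<Sum>j\<le>m. p X j) \<le> 1" for m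
    proof -
      have "(\<Sum>j\<le>m. p X j) \<le> (\<Sum>X\<in>C. \<Sum>j\<le>m. p X j)"
        using that C(1) p_nonneg by (intro member_le_sum sum_nonneg) auto
      then show ?thesis using partial[of m] s_nonneg[of m] by simp
    qed
  qed (rule p_nonneg)
  have hp: "hit_prob C X = suminf (p X)" for X by (simp add: hit_prob_def p_def[abs_def])
  have s_eq: "s m = (\<Sum>X\<in>C. \<Sum>k\<in>overlaps X Y. 2 ^ k * p X (m + k))" for m
  proof -
    have "s m = (\<Sum>X\<in>C. \<Sum>k\<in>overlaps X Y. real (card (hits C X (m + k)))) / 2 ^ m"
      using card_avoiding[OF C, of m] by (simp add: s_def)
    then show ?thesis by (simp add: p_def sum_divide_distrib power_add)
  qed
  \<comment> \<open>The first \<open>k\<close> terms of the series vanish: no word shorter than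
    \<open>n\<close> ends in \<open>X\<close>, and \<open>k \<le> n\<close>.\<close>
  have shift: "(\<lambda>m. p X (m + k)) sums hit_prob C X" if "X \<in> C" "k \<in> overlaps X Y" for X k
  proof -
    have "k \<le> n" using that C(2) by (auto simp: overlaps_def)
    then have "(\<Sum>i<k. p X i) = 0" using p0 that by (intro sum.neutral) auto
    then show ?thesis
      using summable_sums[OF summ[OF that(1)]] hp by (subst sums_iff_shift) simp
  qed
  have tw: "(2::real) ^ k = 2 * 2 ^ (k - 1)" if "k \<in> overlaps X Y" for X k
    using that by (cases k) (auto simp: overlaps_def)
  have "s sums (\<Sum>X\<in>C. \<Sum>k\<in>overlaps X Y. 2 ^ k * hit_prob C X)"
    unfolding s_eq by (intro sums_sum sums_mult shift)
  also have "(\<Sum>X\<in>C. \<Sum>k\<in>overlaps X Y. 2 ^ k * hit_prob C X) = 2 * (\<Sum>X\<in>C. corr X Y * hit_prob C X)"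
    by (auto simp: corr_def weight_def sum_distrib_left sum_distrib_right tw mult.assoc intro!: sum.cong)
  finally show s_sums: "(\<lambda>m. card (avoiding C m) / 2 ^ m) sums (2 * (\<Sum>X\<in>C. corr X Y * hit_prob C X))"
    by (simp add: s_def[abs_def])
  \<comment> \<open>The terms of a convergent series tend to 0, so the game ends almost surely and
    the hitting probabilities add up to 1.\<close>
  have "s \<longlonglongrightarrow> 0"
    using summable_LIMSEQ_zero[OF sums_summable[OF s_sums]] by (simp add: s_def[abs_def])
  then have "(\<lambda>m. 1 - s m) \<longlonglongrightarrow> 1 - 0" by (intro tendsto_intros)
  moreover have "(\<lambda>m. \<Sum>X\<in>C. \<Sum>j\<le>m. p X j) \<longlonglongrightarrow> (\<Sum>X\<in>C. hit_prob C X)"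
    unfolding hp by (intro tendsto_sum summable_LIMSEQ' summ)
  ultimately show "(\<Sum>X\<in>C. hit_prob C X) = 1"
    unfolding partial using LIMSEQ_unique by force
qed

section \<open>The game on infinite sequences of tosses\<close>

lemma space_coin_tosses [simp]: "space coin_tosses = UNIV"
  by (simp add: coin_tosses_def space_stream_space)

lemma sets_stake_eq [measurable]: "{\<omega>. stake m \<omega> = w} \<in> sets coin_tosses"
proof -
  have [measurable]: "(\<lambda>\<omega>. \<omega> !! i) \<in> coin_tosses \<rightarrow>\<^sub>M count_space UNIV" for i
    unfolding coin_tosses_def
    using measurable_snth[of i "measure_pmf (pmf_of_set {Heads, Tails})"] by simp
  have eq: "stake m \<omega> = w \<longleftrightarrow> length w = m \<and> (\<forall>i\<in>{..<m}. \<omega> !! i = w ! i)" for \<omega>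
    by (auto simp: list_eq_iff_nth_eq)
  have "Measurable.pred coin_tosses (\<lambda>\<omega>. stake m \<omega> = w)"
    unfolding eq by measurable
  then show ?thesis by (simp add: pred_def)
qed

lemma emeasure_stake_eq:
  "emeasure coin_tosses {\<omega>. stake (length w) \<omega> = w} = ennreal (1 / 2 ^ length w)"
proof (induction w)
  case Nil
  show ?case using prob_space.emeasure_space_1[OF prob_space_coin_tosses] by simp
next
  case (Cons c w)
  let ?M = "measure_pmf (pmf_of_set {Heads, Tails})"
  have sets: "{\<omega>. stake (length (c # w)) \<omega> = c # w} \<in> sets (stream_space ?M)"
    using sets_stake_eq[of "length (c # w)" "c # w"] by (simp add: coin_tosses_def)
  have "emeasure coin_tosses {\<omega>. stake (length (c # w)) \<omega> = c # w} =
    (\<integral>\<^sup>+t. emeasure coin_tosses {\<omega>. t = c \<and> stake (length w) \<omega> = w} \<partial>?M)"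
    using prob_space.emeasure_stream_space[OF measure_pmf.prob_space_axioms sets] by (simp add: coin_tosses_def space_stream_space)
  also have "\<dots> = (\<integral>\<^sup>+t. ennreal (1 / 2 ^ length w) * indicator {c} t \<partial>?M)"
    by (intro nn_integral_cong) (auto simp: Cons.IH split: split_indicator)
  also have "\<dots> = ennreal (1 / 2 ^ length w) * emeasure ?M {c}"
    by (subst nn_integral_cmult_indicator) auto
  also have "emeasure ?M {c} = ennreal (1 / 2)"
    by (cases c) (simp_all add: emeasure_pmf_single pmf_of_set)
  also have "ennreal (1 / 2 ^ length w) * ennreal (1 / 2) = ennreal (1 / 2 ^ length (c # w))"
    by (subst ennreal_mult[symmetric]) (auto simp: mult.commute)
  finally show ?case .
qed

lemma measure_stake:
  assumes "W \<subseteq> {w. length w = m}"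
  shows "measure coin_tosses {\<omega>. stake m \<omega> \<in> W} = card W / 2 ^ m"
proof -
  interpret prob_space coin_tosses by (rule prob_space_coin_tosses)
  have fin: "finite W" using assms finite_coin_lists finite_subset by blast
  have "{\<omega>. stake m \<omega> \<in> W} = (\<Union>w\<in>W. {\<omega>. stake m \<omega> = w})" by auto
  also have "measure coin_tosses \<dots> = (\<Sum>w\<in>W. measure coin_tosses {\<omega>. stake m \<omega> = w})"
    using fin by (intro finite_measure_finite_Union) (auto simp: disjoint_family_on_def sets_stake_eq)
  also have "\<dots> = (\<Sum>w\<in>W. 1 / 2 ^ m)"
  proof (rule sum.cong)
    fix w assume "w \<in> W"
    then have "length w = m" using assms by auto
    then show "measure coin_tosses {\<omega>. stake m \<omega> = w} = 1 / 2 ^ m"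
      using emeasure_stake_eq[of w] by (simp add: measure_def)
  qed simp
  finally show ?thesis by simp
qed

lemma suffix_stake_iff:
  "suffix X (stake m \<omega>) \<longleftrightarrow> length X \<le> m \<and> occurs_at X \<omega> (m - length X)"
proof (cases "length X \<le> m")
  case True
  then have "stake m \<omega> = stake (m - length X) \<omega> @ stake (length X) (sdrop (m - length X) \<omega>)"
    by (simp add: stake_add)
  with True show ?thesis
    by (metis append_eq_append_conv length_stake occurs_at_def suffix_def)
next
  case False
  then show ?thesis using suffix_length_le by fastforce
qed

lemma sublist_stake_iff:
  assumes "X \<noteq> []"
  shows "sublist X (stake m \<omega>) \<longleftrightarrow> (\<exists>k. k + length X \<le> m \<and> occurs_at X \<omega> k)"
proof (induction m)
  case 0
  then show ?case using assms by auto
next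
  case (Suc m)
  have "sublist X (stake (Suc m) \<omega>) \<longleftrightarrow> suffix X (stake (Suc m) \<omega>) \<or> sublist X (stake m \<omega>)"
    by (simp only: stake_Suc sublist_snoc)
  also have "\<dots> \<longleftrightarrow> (\<exists>k. k + length X \<le> Suc m \<and> occurs_at X \<omega> k)"
  proof -
    have "k + length X \<le> Suc m \<longleftrightarrow>
        k + length X \<le> m \<or> length X \<le> Suc m \<and> k = Suc m - length X" for k
      by arith
    then show ?thesis unfolding suffix_stake_iff Suc.IH by auto
  qed
  finally show ?case .
qed

text \<open>The position in \<open>appears_before\<close> may be a later occurrence of
  \<open>A\<close>, so the least starting position is taken to obtain a first hit.\<close>

lemma appears_before_iff_hits:
  assumes "length A = n" "length B = n" "0 < n" "A \<noteq> B"
  shows "appears_before A B \<omega> \<longleftrightarrow> (\<exists>m. stake m \<omega> \<in> hits {A, B} A m)"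
proof -
  have ne: "A \<noteq> []" "B \<noteq> []" using assms by auto
  have bl: "butlast (stake m \<omega>) = stake (m - 1) \<omega>" for m
    by (cases m) (simp_all only: stake_Suc butlast_snoc stake.simps(1) butlast.simps diff_Suc_1 diff_0_eq_0)
  have hit: "stake m \<omega> \<in> hits {A, B} A m \<longleftrightarrow> n \<le> m \<and> occurs_at A \<omega> (m - n) \<and>
    (\<forall>k. k + n < m \<longrightarrow> \<not> occurs_at A \<omega> k \<and> \<not> occurs_at B \<omega> k)" for m
  proof -
    have "k + n \<le> m - 1 \<longleftrightarrow> k + n < m" for k using assms(3) by arith
    then show ?thesis
      using assms
      by (auto simp add: hits_def avoids_def bl suffix_stake_iff sublist_stake_iff[OF ne(1)]
          sublist_stake_iff[OF ne(2)] simp del: One_nat_def)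
  qed
  show ?thesis
  proof
    assume "appears_before A B \<omega>"
    then obtain k where k: "occurs_at A \<omega> k" "\<forall>j\<le>k. \<not> occurs_at B \<omega> j"
      by (auto simp: appears_before_def)
    define i where "i = (LEAST i. occurs_at A \<omega> i)"
    have "occurs_at A \<omega> i" "i \<le> k" "\<And>j. j < i \<Longrightarrow> \<not> occurs_at A \<omega> j"
      unfolding i_def using k by (auto intro: LeastI Least_le dest: not_less_Least)
    then have "stake (i + n) \<omega> \<in> hits {A, B} A (i + n)"
      unfolding hit using k by auto
    then show "\<exists>m. stake m \<omega> \<in> hits {A, B} A m" by blast
  next
    assume "\<exists>m. stake m \<omega> \<in> hits {A, B} A m"
    then obtain m where m: "n \<le> m" "occurs_at A \<omega> (m - n)"
      "\<And>k. k + n < m \<Longrightarrow> \<not> occurs_at A \<omega> k \<and> \<not> occurs_at B \<omega> k"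
      unfolding hit by blast
    show "appears_before A B \<omega>"
    proof -
      \<comment> \<open>Two different words of equal length cannot start at the same
        position.\<close>
      have "\<not> occurs_at B \<omega> (m - n)" using m(2) assms by (auto simp: occurs_at_def)
      then have "\<forall>j\<le>m - n. \<not> occurs_at B \<omega> j"
        using m(1,3) by (metis le_neq_implies_less less_diff_conv)
      with m show ?thesis by (auto simp: appears_before_def)
    qed
  qed
qed

text \<open>There is at most one first hit, so the events for different \<open>m\<close> are
  disjoint and countable additivity gives the series.\<close>

lemma win_prob_eq_hit_prob:
  assumes "length A = n" "length B = n" "0 < n" "A \<noteq> B"
  shows "win_prob A B = hit_prob {A, B} A"
proof -
  interpret prob_space coin_tosses by (rule prob_space_coin_tosses)
  let ?E = "\<lambda>m. {\<omega>. stake m \<omega> \<in> hits {A, B} A m}"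
  have sub: "hits {A, B} A m \<subseteq> {w. length w = m}" for m
    by (auto simp: hits_def)
  have disj: "stake j \<omega> \<notin> hits {A, B} A j" if "stake i \<omega> \<in> hits {A, B} A i" "i < j" for i j \<omega>
  proof -
    have "suffix A (stake i \<omega>)" using that by (simp add: hits_def)
    moreover have "stake i \<omega> = take i (butlast (stake j \<omega>))"
      using that(2) by (simp add: take_butlast take_stake)
    ultimately have "sublist A (butlast (stake j \<omega>))"
      by (metis sublist_order.order_trans sublist_take suffix_imp_sublist)
    then show ?thesis by (auto simp: hits_def avoids_def)
  qed
  have sets: "?E m \<in> events" for m
  proof -
    have "?E m = (\<Union>w\<in>hits {A, B} A m. {\<omega>. stake m \<omega> = w})" by auto
    then show ?thesis by (simp add: finite_hits sets.finite_UN sets_stake_eq)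
  qed
  have "(\<lambda>m. prob (?E m)) sums prob (\<Union>m. ?E m)"
    by (rule finite_measure_UNION)
      (use disj sets in \<open>auto simp: disjoint_family_on_def, metis linorder_neqE_nat\<close>)
  moreover have "(\<Union>m. ?E m) = {\<omega> \<in> space coin_tosses. appears_before A B \<omega>}"
    using appears_before_iff_hits[OF assms] by auto
  ultimately have "(\<lambda>m. prob (?E m)) sums win_prob A B" by (simp add: win_prob_def)
  then show ?thesis
    using measure_stake[OF sub] by (simp add: hit_prob_def sums_unique)
qed

lemma weight_nonneg: "0 \<le> weight S"
  unfolding weight_def by (simp add: sum_nonneg)

text \<open>Taking \<open>Y = A\<close> and \<open>Y = B\<close> in \<open>avoiding_sums\<close>
  expresses one expected waiting time twice. Equating the two values and using that the hitting
  probabilities add up to 1 determines the odds.\<close>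

theorem conway:
  assumes "length A = n" "length B = n" "A \<noteq> B"
  shows "win_prob A B * (corr A A - corr A B + (corr B B - corr B A)) = corr B B - corr B A"
proof -
  have n: "0 < n" using assms by auto
  let ?C = "{A, B}"
  have C: "finite ?C" "\<And>X. X \<in> ?C \<Longrightarrow> length X = n" using assms by auto
  note sums = avoiding_sums[OF C _ n]
  have 1: "corr A A * hit_prob ?C A + corr B A * hit_prob ?C B =
    corr A B * hit_prob ?C A + corr B B * hit_prob ?C B"
    using sums_unique2[OF sums[of A] sums[of B]] assms(3) by simp
  have B: "hit_prob ?C B = 1 - hit_prob ?C A"
    using sum_hit_prob[OF C(1,2) _ n, of A] assms(3) by simp
  then show ?thesis
    using 1 unfolding win_prob_eq_hit_prob[OF assms(1,2) n assms(3)] B of_int_add of_int_diff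
    by algebra
qed

section \<open>Borders of a word\<close>

definition borders :: "'a list \<Rightarrow> nat set" where
  "borders W = {k. 0 < k \<and> k < length W \<and> drop (length W - k) W = take k W}"

text \<open>The letter tested stands just before the border at the end of \<open>W\<close>, so these
  are the borders that \<open>b\<close> extends to the left.\<close>

definition borders_after :: "'a \<Rightarrow> 'a list \<Rightarrow> nat set" where
  "borders_after b W = {k \<in> borders W. W ! (length W - Suc k) = b}"

text \<open>For the reply \<open>b # butlast A\<close> this is the quantity \<open>u_b\<close> of
  the odds when \<open>W\<close> is \<open>butlast A\<close>, and \<open>v_b\<close> when
  \<open>W\<close> is \<open>A\<close>.\<close>

definition excess :: "'a \<Rightarrow> 'a list \<Rightarrow> int" where
  "excess b W = corr W (b # butlast W) - weight (borders W)"

lemma borders_bounds: "k \<in> borders W \<Longrightarrow> 0 < k \<and> k < length W"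
  by (simp add: borders_def)

lemma finite_borders [simp]: "finite (borders W)"
  by (rule finite_subset[of _ "{..length W}"]) (auto simp: borders_def)

lemma borders_after_subset: "borders_after b W \<subseteq> borders W"
  by (auto simp: borders_after_def)

lemma finite_borders_after [simp]: "finite (borders_after b W)"
  using borders_after_subset finite_subset finite_borders by metis

lemma borders_nth: "k \<in> borders W \<Longrightarrow> i < k \<Longrightarrow> W ! (length W - k + i) = W ! i"
  by (auto simp: borders_def dest!: arg_cong[of _ _ "\<lambda>xs. xs ! i"])

lemma bordersI:
  "0 < k \<Longrightarrow> k < length W \<Longrightarrow> (\<And>i. i < k \<Longrightarrow> W ! (length W - k + i) = W ! i) \<Longrightarrow> k \<in> borders W"
  by (auto simp: borders_def intro!: nth_equalityI)

lemma weight_ge: "finite S \<Longrightarrow> k \<in> S \<Longrightarrow> 2 ^ (k - 1) \<le> weight S"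
  unfolding weight_def by (rule member_le_sum) auto

lemma weight_mono: "finite T \<Longrightarrow> S \<subseteq> T \<Longrightarrow> weight S \<le> weight T"
  unfolding weight_def by (rule sum_mono2) auto

text \<open>A weight is a binary number whose digits mark the elements of the set; with at most
  \<open>m\<close> digits it stays below \<open>2 ^ m\<close>. Later comparisons through largest
  borders rest on this.\<close>

lemma weight_less:
  assumes "\<And>k. k \<in> S \<Longrightarrow> 0 < k \<and> k \<le> m"
  shows "weight S < 2 ^ m"
proof -
  have "weight S \<le> weight {1..m}"
    using assms by (intro weight_mono) force+
  also have "weight {1..m} = 2 ^ m - 1"
    by (induction m) (simp_all add: weight_def)
  finally show ?thesis by simp
qed

lemma weight_insert: "finite S \<Longrightarrow> k \<notin> S \<Longrightarrow> weight (insert k S) = 2 ^ (k - 1) + weight S"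
  by (simp add: weight_def)

lemma weight_Un: "finite S \<Longrightarrow> finite T \<Longrightarrow> S \<inter> T = {} \<Longrightarrow> weight (S \<union> T) = weight S + weight T"
  by (simp add: weight_def sum.union_disjoint)

lemma weight_empty [simp]: "weight {} = 0"
  by (simp add: weight_def)

lemma weight_Suc:
  assumes "0 \<notin> S"
  shows "weight (Suc ` S) = 2 * weight S"
proof -
  have "weight (Suc ` S) = (\<Sum>k\<in>S. 2 ^ k)"
    by (simp add: weight_def sum.reindex)
  also have "\<dots> = (\<Sum>k\<in>S. 2 * 2 ^ (k - 1))"
    using assms by (intro sum.cong) (auto simp: power_eq_if intro!: gr0I)
  finally show ?thesis by (simp add: weight_def sum_distrib_left)
qed

lemma even_weight_iff:
  assumes "finite S" "0 \<notin> S"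
  shows "even (weight S) \<longleftrightarrow> 1 \<notin> S"
proof -
  have *: "even (weight (S - {1}))"
    unfolding weight_def using assms(2) by (intro dvd_sum) (auto, metis One_nat_def Suc_lessI gr0I zero_less_diff)
  show ?thesis
  proof (cases "1 \<in> S")
    case True
    then have "weight S = 1 + weight (S - {1})"
      using weight_insert[of "S - {1}" 1] assms(1) by (simp add: insert_absorb)
    with * True show ?thesis by simp
  qed (use * in simp)
qed

lemma overlaps_self: "W \<noteq> [] \<Longrightarrow> overlaps W W = insert (length W) (borders W)"
  by (auto simp: overlaps_def borders_def)

lemma corr_self: "W \<noteq> [] \<Longrightarrow> corr W W = 2 ^ (length W - 1) + weight (borders W)"
  unfolding corr_def overlaps_self by (subst weight_insert) (auto dest: borders_bounds)

text \<open>An overlap of length \<open>Suc j\<close> is a letter \<open>b\<close> followed by a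
  border of length \<open>j\<close>. For \<open>j = 0\<close> no border is left and only the last
  letter of \<open>W\<close> matters.\<close>

lemma overlaps_Cons_butlast:
  assumes "W \<noteq> []"
  shows "overlaps W (b # butlast W) = (if last W = b then {1} else {}) \<union> Suc ` borders_after b W"
proof (rule set_eqI)
  fix k
  show "k \<in> overlaps W (b # butlast W) \<longleftrightarrow>
    k \<in> (if last W = b then {1} else {}) \<union> Suc ` borders_after b W"
  proof (cases k)
    case 0
    then show ?thesis by (auto simp: overlaps_def)
  next
    case (Suc j)
    show ?thesis
    proof (cases "j < length W")
      case False
      then have "0 < j" using assms by (cases j) auto
      with Suc False show ?thesis
        by (auto simp: overlaps_def borders_after_def borders_def)
    next
      case True
      then have "drop (length W - k) W = W ! (length W - Suc j) # drop (length W - j) W"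
        using Suc by (simp add: Cons_nth_drop_Suc[symmetric] Suc_diff_Suc)
      moreover have "take k (b # butlast W) = b # take j W"
        using True Suc by (simp add: take_butlast)
      ultimately show ?thesis
        using True Suc assms
        by (cases "j = 0") (auto simp: overlaps_def borders_after_def borders_def last_conv_nth
            image_iff Suc_le_eq)
    qed
  qed
qed

lemma corr_Cons_butlast:
  assumes "W \<noteq> []"
  shows "corr W (b # butlast W) = of_bool (last W = b) + 2 * weight (borders_after b W)"
proof -
  have "0 \<notin> borders_after b W" by (auto simp: borders_after_def borders_def)
  then show ?thesis
    unfolding corr_def overlaps_Cons_butlast[OF assms]
    by (subst weight_Un) (auto simp: weight_Suc weight_def[of "{Suc 0}"])
qed

lemma corr_Cons_self:
  assumes "V \<noteq> []"
  shows "corr (b # V) (b # V) = 2 ^ length V + corr V (b # butlast V)"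
proof -
  have "overlaps (b # V) (b # V) = insert (Suc (length V)) (overlaps V (b # butlast V))"
    (is "?L = ?R")
  proof (rule set_eqI)
    fix k
    show "k \<in> ?L \<longleftrightarrow> k \<in> ?R"
    proof (cases "0 < k \<and> k \<le> length V")
      case True
      then show ?thesis
        by (auto simp: overlaps_def Suc_diff_le take_Cons' take_butlast)
    qed (use assms in \<open>auto simp: overlaps_def\<close>)
  qed
  then show ?thesis
    unfolding corr_def by (simp add: weight_insert overlaps_def)
qed

lemma corr_Cons_butlast_left:
  assumes "butlast A \<noteq> []" "b # butlast A \<noteq> A"
  shows "corr (b # butlast A) A = corr (butlast A) (butlast A)"
proof -
  obtain V a where A: "A = V @ [a]" using assms(1) by (cases A rule: rev_cases) auto
  have "overlaps (b # butlast A) A = overlaps (butlast A) (butlast A)" (is "?L = ?R")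
  proof (rule set_eqI)
    fix k
    show "k \<in> ?L \<longleftrightarrow> k \<in> ?R"
    proof (cases "0 < k \<and> k \<le> length V")
      case True
      then show ?thesis
        by (auto simp: A overlaps_def Suc_diff_le)
    next
      case False
      then have "k = 0 \<or> k = Suc (length V) \<or> Suc (length V) < k" by arith
      then show ?thesis using assms(2) by (auto simp: A overlaps_def)
    qed
  qed
  then show ?thesis by (simp add: corr_def)
qed

text \<open>These are the two sides of Conway's odds for the reply \<open>b # butlast A\<close>.
  They reduce to borders because removing the first letter of the reply or the last letter of
  \<open>A\<close> leaves the same word \<open>butlast A\<close>.\<close>

lemma corr_differences:
  assumes "length A = n" "2 \<le> n" "b # butlast A \<noteq> A"
  shows "corr (b # butlast A) (b # butlast A) - corr (b # butlast A) A = 2 ^ (n - 2) + excess b (butlast A)"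
    and "corr A A - corr A (b # butlast A) = 2 * 2 ^ (n - 2) - excess b A"
proof -
  have ne: "butlast A \<noteq> []" "A \<noteq> []" using assms by (auto simp flip: length_greater_0_conv)
  have p: "(2::int) ^ (n - 1) = 2 * 2 ^ (n - 2)"
    using assms(2) by (cases n) (auto simp: Suc_le_eq power_eq_if numeral_2_eq_2)
  have l: "length (butlast A) = n - 1" "length (butlast A) - 1 = n - 2" using assms(1) by auto
  show "corr (b # butlast A) (b # butlast A) - corr (b # butlast A) A = 2 ^ (n - 2) + excess b (butlast A)"
    unfolding corr_Cons_self[OF ne(1), of b] corr_Cons_butlast_left[OF ne(1) assms(3)]
      corr_self[OF ne(1)] excess_def l p by simp
  show "corr A A - corr A (b # butlast A) = 2 * 2 ^ (n - 2) - excess b A"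
    unfolding corr_self[OF ne(2)] excess_def assms(1) p by simp
qed

lemma excess_eq:
  "W \<noteq> [] \<Longrightarrow> excess b W = of_bool (last W = b) + 2 * weight (borders_after b W) - weight (borders W)"
  by (simp add: excess_def corr_Cons_butlast)

lemma coin_cases: "b \<noteq> c \<Longrightarrow> x = b \<or> x = c" for b c x :: coin
  by (cases b; cases c; cases x) auto

lemma borders_split:
  fixes W :: "coin list"
  assumes "b \<noteq> c"
  shows "borders W = borders_after b W \<union> borders_after c W" "borders_after b W \<inter> borders_after c W = {}"
proof -
  show "borders W = borders_after b W \<union> borders_after c W"
  proof (rule set_eqI)
    fix k
    show "k \<in> borders W \<longleftrightarrow> k \<in> borders_after b W \<union> borders_after c W"
      using coin_cases[OF assms, of "W ! (length W - Suc k)"] by (auto simp: borders_after_def)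
  qed
qed (use assms in \<open>auto simp: borders_after_def\<close>)

lemma excess_split:
  fixes W :: "coin list"
  assumes "b \<noteq> c" "W \<noteq> []"
  shows "excess b W = of_bool (last W = b) + weight (borders_after b W) - weight (borders_after c W)"
  using borders_split[OF assms(1), of W] weight_Un[of "borders_after b W" "borders_after c W"] assms(2)
  by (simp add: excess_eq)

text \<open>Every border is preceded by exactly one of the two letters, so the border terms cancel
  in the sum and the last letter contributes the 1.\<close>

lemma excess_add:
  fixes W :: "coin list"
  assumes "b \<noteq> c" "W \<noteq> []"
  shows "excess b W + excess c W = 1"
  using excess_split[OF assms] excess_split[OF assms(1)[symmetric] assms(2)] coin_cases[OF assms(1), of "last W"]
    assms(1) by auto

lemma one_mem_borders_iff: "2 \<le> length W \<Longrightarrow> 1 \<in> borders W \<longleftrightarrow> last W = hd W"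
  by (cases W rule: rev_cases) (auto simp: borders_def take_Suc hd_append)

text \<open>Modulo 2 only the border of length 1 counts. It is present exactly when the first and
  last letters agree, so it cancels the term for the last letter.\<close>

lemma even_excess_hd: "2 \<le> length W \<Longrightarrow> even (excess (hd W) W)"
proof -
  assume l: "2 \<le> length W"
  have "W \<noteq> []" using l by auto
  moreover have "even (weight (borders W)) \<longleftrightarrow> last W \<noteq> hd W"
    using one_mem_borders_iff[OF l] even_weight_iff[of "borders W"] by (auto dest: borders_bounds)
  ultimately show ?thesis by (simp add: excess_eq)
qed

lemma excess_gt:
  assumes "W \<noteq> []"
  shows "- (2 ^ (length W - 1)) < excess b W"
proof -
  have "weight (borders W) < 2 ^ (length W - 1)"
    by (rule weight_less) (auto dest: borders_bounds)
  then show ?thesis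
    using weight_nonneg[of "borders_after b W"] assms by (auto simp: excess_eq)
qed

lemma excess_le:
  assumes "W \<noteq> []"
  shows "excess b W \<le> 2 ^ (length W - 1)"
proof -
  have "weight (borders_after b W) < 2 ^ (length W - 1)"
    by (rule weight_less) (auto simp: borders_after_def dest: borders_bounds)
  then show ?thesis
    using weight_mono[OF finite_borders borders_after_subset, of b W] assms by (auto simp: excess_eq)
qed

text \<open>A border of length \<open>Suc k\<close> would begin with the letter \<open>b\<close>
  that precedes the border of length \<open>k\<close>, but every border begins with
  \<open>hd W\<close>.\<close>

lemma Suc_notin_borders:
  assumes "k \<in> borders_after b W" "b \<noteq> hd W"
  shows "Suc k \<notin> borders W"
proof
  assume "Suc k \<in> borders W"
  from borders_nth[OF this, of 0] have "W ! (length W - Suc k) = W ! 0" by simp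
  moreover have "W \<noteq> []" using assms by (auto simp: borders_after_def borders_def)
  ultimately show False using assms by (auto simp: borders_after_def borders_def hd_conv_nth)
qed

lemma borders_after_butlast:
  assumes "Suc k \<in> borders_after b A" "0 < k"
  shows "k \<in> borders_after b (butlast A)"
proof -
  let ?V = "butlast A"
  have k: "Suc k \<in> borders A" "A ! (length A - Suc (Suc k)) = b" "Suc k < length A"
    using assms by (auto simp: borders_after_def borders_def)
  have "k \<in> borders ?V"
  proof (rule bordersI)
    fix i assume "i < k"
    then show "?V ! (length ?V - k + i) = ?V ! i"
      using borders_nth[OF k(1), of i] k(3) by (simp add: nth_butlast)
  qed (use assms k in auto)
  then show ?thesis using k by (simp add: borders_after_def nth_butlast)
qed

text \<open>Removing the last letter of \<open>A\<close> shortens every border by 1 and keeps the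
  letter before it. Only a border of length 1 disappears, which accounts for the 1.\<close>

lemma weight_borders_after_butlast:
  "weight (borders_after b A) \<le> 2 * weight (borders_after b (butlast A)) + 1"
proof -
  have "borders_after b A \<subseteq> insert 1 (Suc ` borders_after b (butlast A))"
  proof
    fix k assume k: "k \<in> borders_after b A"
    then have "0 < k" by (auto simp: borders_after_def borders_def)
    then obtain j where j: "k = Suc j" by (cases k) auto
    then show "k \<in> insert 1 (Suc ` borders_after b (butlast A))"
      using borders_after_butlast[of j b A] k by (cases "j = 0") auto
  qed
  then have "weight (borders_after b A) \<le> weight (insert 1 (Suc ` borders_after b (butlast A)))"
    by (intro weight_mono) auto
  also have "\<dots> = 1 + weight (Suc ` borders_after b (butlast A))"
    by (subst weight_insert) (auto simp: borders_after_def borders_def)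
  also have "weight (Suc ` borders_after b (butlast A)) = 2 * weight (borders_after b (butlast A))"
    by (rule weight_Suc) (auto simp: borders_after_def borders_def)
  finally show ?thesis by simp
qed

section \<open>Optimal strategies\<close>

definition core :: "'a \<Rightarrow> nat \<Rightarrow> 'a list set" where
  "core a N = {W. length W = N \<and> W ! 0 = a \<and> W ! 1 \<noteq> a \<and> W ! (N - 2) \<noteq> a \<and> W ! (N - 1) = a \<and>
    borders W = {1}}"

text \<open>The last two inequalities say that neither reply pushes the odds below
  \<open>x + 1 : 2x + 1\<close>. With \<open>u = 2p\<close>, \<open>v = 2q\<close> and
  \<open>c = 2p + q\<close> the first right-hand side is \<open>2 (c (x + 1) - p)\<close>, and the
  bounds on \<open>u\<close> leave only \<open>c = 1\<close>.\<close>

lemma excess_arith: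
  fixes u v x :: int
  assumes "even u" "even v" "- x < u" "u \<le> x"
    "x \<le> u * (2 * x + 1) + v * (x + 1)" "x \<le> (1 - u) * (2 * x + 1) + (1 - v) * (x + 1)"
  shows "0 \<le> u \<and> v = 2 - 2 * u"
proof -
  obtain p q where p: "u = 2 * p" and q: "v = 2 * q" using assms by (auto elim!: evenE)
  define c where "c = 2 * p + q"
  have eq: "u * (2 * x + 1) + v * (x + 1) = 2 * (c * (x + 1) - p)"
    by (simp add: p q c_def algebra_simps)
  have lo: "x \<le> 2 * (c * (x + 1) - p)" and hi: "2 * (c * (x + 1) - p) \<le> 2 * x + 2"
    using assms(5,6) eq by (simp_all add: algebra_simps)
  have "\<not> c \<le> 0"
  proof
    assume "c \<le> 0"
    then have "c * (x + 1) \<le> 0" using assms(3,4) by (intro mult_nonpos_nonneg) auto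
    then show False using lo assms(3) p by simp
  qed
  moreover have "\<not> 2 \<le> c"
  proof
    assume "2 \<le> c"
    define w where "w = c * (x + 1)"
    have "2 * (x + 1) \<le> w" unfolding w_def using assms(3,4) \<open>2 \<le> c\<close> by (intro mult_right_mono) auto
    then show False using hi assms(3,4) p unfolding w_def[symmetric] by simp
  qed
  ultimately have "c = 1" by simp
  then show ?thesis using hi by (simp add: p q c_def)
qed

lemma weight_pos_imp_nonempty: "0 < weight S \<Longrightarrow> S \<noteq> {}"
  by auto

lemma weight_less_Max:
  assumes "finite S" "0 \<notin> S"
  shows "weight S < 2 ^ Max S"
proof (rule weight_less)
  fix k assume "k \<in> S"
  then show "0 < k \<and> k \<le> Max S" using assms by (metis Max_ge gr0I)
qed

lemma zero_notin_borders_after [simp]: "0 \<notin> borders_after b W"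
  by (auto simp: borders_after_def borders_def)

text \<open>Parity leaves \<open>u \<ge> 2\<close>, which is contradictory, or \<open>u = 0\<close>.
  In both cases weights are compared through their largest borders, and
  \<open>Suc_notin_borders\<close> keeps a border after the other letter \<open>c\<close> from being
  one shorter than another border.\<close>

lemma optimal_structure:
  fixes A :: "coin list"
  assumes n: "length A = n" "4 \<le> n" and a: "hd A = a"
    and u: "0 \<le> excess a (butlast A)" and v: "excess a A = 2 - 2 * excess a (butlast A)"
  shows "\<exists>V\<in>core a (n - 1). A = V @ [a]"
proof -
  define V where "V = butlast A"
  obtain c where c: "c \<noteq> a" by (metis coin.distinct(1))
  have ne: "A \<noteq> []" "V \<noteq> []" using n by (auto simp: V_def simp flip: length_greater_0_conv)
  have lV: "length V = n - 1" using n by (simp add: V_def)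
  have hd: "hd V = a" using n a by (cases A) (auto simp: V_def)
  have V_nth: "V ! i = A ! i" if "i < n - 1" for i using that n by (simp add: V_def nth_butlast)
  have A0: "A ! 0 = a" using a ne by (simp add: hd_conv_nth)
  let ?h = "weight (borders_after a V)" and ?t = "weight (borders_after c V)"
  let ?h' = "weight (borders_after a A)" and ?t' = "weight (borders_after c A)"
  have U: "excess a V = of_bool (last V = a) + ?h - ?t"
    using excess_split[OF c[symmetric] ne(2)] .
  have E: "excess a A = of_bool (last A = a) + ?h' - ?t'"
    using excess_split[OF c[symmetric] ne(1)] .
  have disj: "k \<notin> borders_after c W" if "k \<in> borders_after a W" for k W
    using that c by (auto simp: borders_after_def)
  have notin: "Suc k \<notin> borders_after a W" if "k \<in> borders_after c W" "hd W = a" for k W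
    using Suc_notin_borders[OF that(1)] that(2) c by (auto simp: borders_after_def)
  have gt0: "0 < k" if "k \<in> borders_after b W" for k b W
    using that by (auto intro!: gr0I)
  have "even (excess a V)" using even_excess_hd[of V] lV n hd by simp
  then consider "2 \<le> excess a V" | "excess a V = 0"
    using u unfolding V_def[symmetric] by (elim evenE) force
  then show ?thesis
  proof cases
    case 1
    \<comment> \<open>The longest border of \<open>V\<close> after \<open>c\<close> is shorter by at least 2 than some border after \<open>a\<close>,
      which makes \<open>?h\<close> larger than \<open>2 * ?t + 1\<close>.\<close>
    have t': "?t' \<le> 2 * ?t + 1" unfolding V_def by (rule weight_borders_after_butlast)
    have vv: "?t' = of_bool (last A = a) + ?h' + 2 * excess a V - 2"
      using v E by (simp add: V_def)
    have h'0: "0 \<le> ?h'" by (rule weight_nonneg)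
    have "1 \<le> ?t" and h_gt: "?t < ?h" and h_le: "?h \<le> 2 * ?t + 1"
      using vv t' h'0 1 U by (auto split: if_splits simp: of_bool_def)
    define K where "K = Max (borders_after c V)"
    have K: "K \<in> borders_after c V"
      unfolding K_def using \<open>1 \<le> ?t\<close> weight_pos_imp_nonempty[of "borders_after c V"] by auto
    have tK: "?t < 2 ^ K" unfolding K_def by (rule weight_less_Max) auto
    have "\<exists>J\<in>borders_after a V. K < J"
    proof (rule ccontr)
      assume no: "\<not> (\<exists>J\<in>borders_after a V. K < J)"
      have "?h < 2 ^ (K - 1)"
      proof (intro weight_less)
        fix k assume k: "k \<in> borders_after a V"
        then have "k \<noteq> K" "\<not> K < k" using disj[OF k] K no by auto
        then show "0 < k \<and> k \<le> K - 1" using gt0[OF k] by simp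
      qed
      also have "\<dots> \<le> ?t" using K by (intro weight_ge) auto
      finally show False using h_gt by simp
    qed
    then obtain J where J: "J \<in> borders_after a V" "K < J" by blast
    have "J \<noteq> Suc K" using notin[OF K hd] J by auto
    then have "(2::int) ^ Suc K \<le> 2 ^ (J - 1)" using J by (intro power_increasing) auto
    also have "\<dots> \<le> ?h" using J by (intro weight_ge) auto
    finally show ?thesis using tK h_le by simp
  next
    case 2
    have t: "?t = ?h + of_bool (last V = a)" using 2 U by simp
    have h': "?h' = ?t' + 2 - of_bool (last A = a)" using v E 2 by (simp add: V_def)
    have t'0: "0 \<le> ?t'" and h0: "0 \<le> ?h" by (rule weight_nonneg)+
    \<comment> \<open>The leading binary digit of \<open>?h'\<close> belongs to \<open>J\<close>, so
      \<open>?h' < 2 ^ J\<close>. As \<open>?h'\<close> exceeds \<open>?t'\<close> by 1 or 2, no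
      border of \<open>A\<close> after \<open>c\<close> reaches \<open>J\<close>.\<close>
    define J where "J = Max (borders_after a A)"
    have "1 \<le> ?h'" using h' t'0 by (auto simp: of_bool_def split: if_splits)
    then have J: "J \<in> borders_after a A" and J_max: "\<And>k. k \<in> borders_after a A \<Longrightarrow> k \<le> J"
      unfolding J_def using weight_pos_imp_nonempty[of "borders_after a A"] by auto
    have h'J: "?h' < 2 ^ J" unfolding J_def by (rule weight_less_Max) auto
    have J_h': "2 ^ (J - 1) \<le> ?h'" using J by (intro weight_ge) auto
    have J_c: "k < J" if k: "k \<in> borders_after c A" for k
    proof (rule ccontr)
      assume "\<not> k < J"
      then have "J \<le> k - 1" using disj[OF J] k gt0[OF k] by (cases "J = k") auto
      then have "(2::int) ^ J \<le> 2 ^ (k - 1)" by (intro power_increasing) auto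
      also have "\<dots> \<le> ?t'" using k by (intro weight_ge) auto
      finally show False using h'J h' by (auto simp: of_bool_def split: if_splits)
    qed
    have J_c2: "k \<le> J - 2" if k: "k \<in> borders_after c A" for k
    proof -
      have "k < J" "J \<noteq> Suc k" using J_c[OF k] notin[OF k a] J by auto
      then show ?thesis by simp
    qed
    \<comment> \<open>Borders after \<open>c\<close> are at least 2 shorter than \<open>J\<close>,
      so for \<open>J > 2\<close> the two weights would differ by more than 2.\<close>
    have "J \<le> 2"
    proof (rule ccontr)
      assume J2: "\<not> J \<le> 2"
      have "?t' < 2 ^ (J - 2)" using J_c2 gt0 by (intro weight_less) auto
      moreover have "(2::int) ^ (J - 1) = 2 * 2 ^ (J - 2)" 
        using J2 by (metis Suc_diff_Suc diff_Suc_1 not_le_imp_less numeral_2_eq_2 One_nat_def power_Suc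
            Suc_lessD)
      moreover have "(2::int) \<le> 2 ^ (J - 2)" using J2 power_increasing[of 1 "J - 2" "2::int"] by simp
      moreover have "0 \<le> (of_bool (last A = a) :: int)" by simp
      ultimately show False using J_h' h' by linarith
    qed
    have c_empty: "borders_after c A = {}"
    proof (rule equals0I)
      fix k assume k: "k \<in> borders_after c A"
      show False using J_c2[OF k] gt0[OF k] \<open>J \<le> 2\<close> by simp
    qed
    then have h'2: "?h' = 2 - of_bool (last A = a)" using h' by simp
    have A_last: "last A = A ! (n - 1)" using ne n by (simp add: last_conv_nth)
    have V_last: "last V = A ! (n - 2)"
      using ne lV n V_nth[of "n - 2"] by (simp add: last_conv_nth numeral_2_eq_2)
    have JA: "J \<in> borders A" "A ! (n - Suc J) = a" using J n by (auto simp: borders_after_def)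
    have last_V: "last V = a"
    proof (cases "J = 1")
      case True
      then show ?thesis using JA V_last by (simp add: numeral_2_eq_2)
    next
      case False
      then have "J = 2" using \<open>J \<le> 2\<close> gt0[OF J] by simp
      then show ?thesis using borders_nth[OF JA(1), of 0] V_last A0 n by simp
    qed
    have t1: "?t = ?h + 1" using t last_V by simp
    \<comment> \<open>The comparison is repeated for \<open>V\<close> with the letters exchanged:
      since \<open>?t = ?h + 1\<close>, the largest border now comes after \<open>c\<close>.\<close>
    define K where "K = Max (borders_after c V)"
    have K: "K \<in> borders_after c V" and K_max: "\<And>k. k \<in> borders_after c V \<Longrightarrow> k \<le> K"
      unfolding K_def using t1 h0 weight_pos_imp_nonempty[of "borders_after c V"] by auto
    have KV: "K \<in> borders V" "V ! (n - 1 - Suc K) = c"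
      using K lV by (auto simp: borders_after_def)
    have tK: "?t < 2 ^ K" unfolding K_def by (rule weight_less_Max) auto
    have K_a: "k < K" if k: "k \<in> borders_after a V" for k
    proof (rule ccontr)
      assume "\<not> k < K"
      then have "K \<le> k - 1" using disj[OF k] K gt0[OF k] by (cases "K = k") auto
      then have "(2::int) ^ K \<le> 2 ^ (k - 1)" by (intro power_increasing) auto
      also have "\<dots> \<le> ?h" using k by (intro weight_ge) auto
      finally show False using tK t1 by simp
    qed
    \<comment> \<open>For \<open>K \<ge> 2\<close> the equation \<open>?t = ?h + 1\<close> needs the
      border \<open>K - 1\<close> after \<open>a\<close>, since otherwise
      \<open>?h < 2 ^ (K - 2)\<close>. Borders of consecutive lengths then force the first two
      letters of \<open>V\<close> to agree.\<close>
    have K_A1: "A ! 1 = a" if K1: "K \<noteq> 1"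
    proof -
      have K2: "2 \<le> K" using K1 gt0[OF K] by simp
      have "K - 1 \<in> borders_after a V"
      proof (rule ccontr)
        assume no: "K - 1 \<notin> borders_after a V"
        have "k \<le> K - 2" if "k \<in> borders_after a V" for k
        proof -
          have "k < K" "k \<noteq> K - 1" using K_a[OF that] that no by auto
          then show ?thesis by simp
        qed
        then have "?h < 2 ^ (K - 2)" using gt0 by (intro weight_less) auto
        moreover have "2 ^ (K - 1) \<le> ?t" using K by (intro weight_ge) auto
        moreover have "(2::int) ^ (K - 1) = 2 * 2 ^ (K - 2)" 
        using K2 by (metis Suc_diff_le diff_Suc_Suc numeral_2_eq_2 One_nat_def power_Suc)
        moreover have "(1::int) \<le> 2 ^ (K - 2)" by simp
        ultimately show False using t1 by linarith
      qed
      then have "K - 1 \<in> borders V" by (simp add: borders_after_def)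
      from borders_nth[OF this, of 0] have 1: "V ! (n - 1 - (K - 1)) = V ! 0" using K2 lV by simp
      from borders_nth[OF KV(1), of 1] have 2: "V ! (n - 1 - K + 1) = V ! 1" using K2 lV by simp
      have "K < n - 1" using KV(1) lV borders_bounds by fastforce
      then have "n - 1 - (K - 1) = n - 1 - K + 1" using K2 by simp
      then have "V ! 1 = V ! 0" using 1 2 by (simp only:)
      then show ?thesis using V_nth[of 0] V_nth[of 1] n A0 by simp
    qed
    \<comment> \<open>With \<open>J = 2\<close> the letter \<open>A ! (n - 3)\<close> would be
      \<open>a\<close>, as it precedes the border 2 of \<open>A\<close>, and also \<open>c\<close>,
      as it precedes the border \<open>K = 1\<close> of \<open>V\<close>.\<close>
    have "J = 1"
    proof (rule ccontr)
      assume "J \<noteq> 1"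
      then have J2: "J = 2" using \<open>J \<le> 2\<close> gt0[OF J] by simp
      then have "last A \<noteq> a" using h'2 J_h' by (auto simp: of_bool_def split: if_splits)
      moreover have "A ! (n - 1) = A ! 1"
        using borders_nth[OF JA(1), of 1] J2 n by (simp add: numeral_2_eq_2 Suc_diff_Suc)
      ultimately have "A ! 1 \<noteq> a" using A_last by simp
      then have "K = 1" using K_A1 by blast
      then have "A ! (n - 3) = c" using KV(2) V_nth[of "n - 3"] n by (simp add: numeral_3_eq_3)
      moreover have "A ! (n - 3) = a" using JA(2) J2 by (simp add: numeral_3_eq_3)
      ultimately show False using c by simp
    qed
    have bA: "borders A = {1}"
    proof -
      have "k = 1" if "k \<in> borders_after a A" for k
        using J_max[OF that] gt0[OF that] \<open>J = 1\<close> by simp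
      then have "borders_after a A = {1}" using J \<open>J = 1\<close> by blast
      then show ?thesis unfolding borders_split(1)[OF c, of A] c_empty by simp
    qed
    have "?h' < 2" using h'J \<open>J = 1\<close> by simp
    then have last_A: "last A = a" using h'2 by (cases "last A = a") simp_all
    \<comment> \<open>Otherwise \<open>A\<close> begins and ends with \<open>a\<close> twice, which
      makes 2 a border.\<close>
    have A1: "A ! 1 \<noteq> a"
    proof
      assume A1: "A ! 1 = a"
      have "2 \<in> borders A"
      proof (rule bordersI)
        fix i :: nat assume "i < 2"
        then have "i = 0 \<or> i = 1" by auto
        then show "A ! (length A - 2 + i) = A ! i"
          using A1 A0 last_A last_V A_last V_last n by (auto simp: numeral_2_eq_2 Suc_diff_Suc)
      qed (use n in auto)
      then show False using bA by simp
    qed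
    then have "K = 1" using K_A1 by blast
    have aV: "borders_after a V = {}"
    proof (rule equals0I)
      fix k assume k: "k \<in> borders_after a V"
      show False using K_a[OF k] gt0[OF k] \<open>K = 1\<close> by simp
    qed
    have bV: "borders V = {1}"
    proof -
      have "k = 1" if "k \<in> borders_after c V" for k
        using K_max[OF that] gt0[OF that] \<open>K = 1\<close> by simp
      then have "borders_after c V = {1}" using K \<open>K = 1\<close> by blast
      then show ?thesis unfolding borders_split(1)[OF c, of V] aV by simp
    qed
    have "V ! (n - 1 - 2) \<noteq> a" using KV(2) \<open>K = 1\<close> c by (simp add: numeral_2_eq_2)
    moreover have "V ! (n - 1 - 1) = a" using last_V lV ne by (simp add: last_conv_nth)
    moreover have "V ! 0 = a" "V ! 1 \<noteq> a" using A0 A1 V_nth[of 0] V_nth[of 1] n by auto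
    ultimately have "V \<in> core a (n - 1)" using lV bV by (simp add: core_def)
    moreover have "A = V @ [a]" using last_A ne unfolding V_def by (metis append_butlast_last_id)
    ultimately show ?thesis by blast
  qed
qed

section \<open>The probability that Player I can guarantee\<close>

definition optimal_value :: "nat \<Rightarrow> real" where
  "optimal_value n = (2 ^ (n - 2) + 1) / (3 * 2 ^ (n - 2) + 2)"

lemma corr_less:
  assumes "length A = n" "length B = n" "A \<noteq> B"
  shows "corr A B < 2 ^ (n - 1)"
  unfolding corr_def
proof (rule weight_less)
  fix k assume k: "k \<in> overlaps A B"
  have "k \<noteq> n" using k assms by (auto simp: overlaps_def)
  then show "0 < k \<and> k \<le> n - 1" using k assms by (auto simp: overlaps_def)
qed

lemma corr_nonneg: "0 \<le> corr A B"
  by (simp add: corr_def weight_nonneg)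

lemma corr_self_ge: "W \<noteq> [] \<Longrightarrow> 2 ^ (length W - 1) \<le> corr W W"
  by (simp add: corr_self weight_nonneg)

lemma corr_differences_pos:
  assumes "length A = n" "length B = n" "A \<noteq> B"
  shows "0 < corr A A - corr A B" "0 < corr B B - corr B A"
proof -
  have "A \<noteq> []" "B \<noteq> []" using assms by auto
  then show "0 < corr A A - corr A B" "0 < corr B B - corr B A"
    using corr_self_ge[of A] corr_self_ge[of B] corr_less[OF assms]
      corr_less[OF assms(2,1) assms(3)[symmetric]] assms by auto
qed

text \<open>\<open>optimal_value n\<close> is the probability belonging to the odds
  \<open>x + 1 : 2x + 1\<close>. Both sides of Conway's odds are positive integers, so the
  comparison can be cross-multiplied and moved to the integers.\<close>

lemma win_prob_compare:
  assumes "length A = n" "length B = n" "A \<noteq> B"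
  defines "D \<equiv> corr B B - corr B A" and "Q \<equiv> corr A A - corr A B" and "x \<equiv> 2 ^ (n - 2)"
  shows "win_prob A B < optimal_value n \<longleftrightarrow> D * (2 * x + 1) < Q * (x + 1)"
    and "win_prob A B = optimal_value n \<longleftrightarrow> D * (2 * x + 1) = Q * (x + 1)"
proof -
  define d q y where "d = real_of_int D" and "q = real_of_int Q" and "y = real_of_int x"
  have pos: "0 < d" "0 < q" "0 < y"
    using corr_differences_pos[OF assms(1-3)] by (auto simp: d_def q_def y_def D_def Q_def x_def)
  have "win_prob A B * (q + d) = d"
    using conway[OF assms(1-3)] by (simp add: d_def q_def D_def Q_def)
  then have w: "win_prob A B = d / (q + d)" using pos by (simp add: field_simps)
  have v: "optimal_value n = (y + 1) / (3 * y + 2)"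
    by (simp add: optimal_value_def y_def x_def)
  have "win_prob A B < optimal_value n \<longleftrightarrow> d * (2 * y + 1) < q * (y + 1)"
    unfolding w v using pos by (simp add: divide_simps) (simp add: algebra_simps)
  also have "\<dots> \<longleftrightarrow> D * (2 * x + 1) < Q * (x + 1)"
    unfolding d_def q_def y_def by (simp flip: of_int_less_iff[where 'a = real])
  finally show "win_prob A B < optimal_value n \<longleftrightarrow> D * (2 * x + 1) < Q * (x + 1)" .
  have "win_prob A B = optimal_value n \<longleftrightarrow> d * (2 * y + 1) = q * (y + 1)"
    unfolding w v using pos by (simp add: divide_simps) (simp add: algebra_simps)
  also have "\<dots> \<longleftrightarrow> D * (2 * x + 1) = Q * (x + 1)"
    unfolding d_def q_def y_def by (simp flip: of_int_eq_iff[where 'a = real])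
  finally show "win_prob A B = optimal_value n \<longleftrightarrow> D * (2 * x + 1) = Q * (x + 1)" .
qed

lemma win_prob_Cons_butlast:
  fixes A :: "coin list"
  assumes "length A = n" "2 \<le> n" "b # butlast A \<noteq> A"
  defines "u \<equiv> excess b (butlast A)" and "v \<equiv> excess b A" and "x \<equiv> 2 ^ (n - 2)"
  shows "win_prob A (b # butlast A) < optimal_value n \<longleftrightarrow> u * (2 * x + 1) + v * (x + 1) < x"
    and "win_prob A (b # butlast A) = optimal_value n \<longleftrightarrow> u * (2 * x + 1) + v * (x + 1) = x"
proof -
  have "length (b # butlast A) = n" using assms(1,2) by auto
  note compare = win_prob_compare[OF assms(1) this assms(3)[symmetric],
      unfolded corr_differences[OF assms(1-3)], folded u_def v_def x_def]
  show "win_prob A (b # butlast A) < optimal_value n \<longleftrightarrow> u * (2 * x + 1) + v * (x + 1) < x"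
    unfolding compare(1) by (simp add: algebra_simps)
  show "win_prob A (b # butlast A) = optimal_value n \<longleftrightarrow> u * (2 * x + 1) + v * (x + 1) = x"
    unfolding compare(2) by (auto simp add: algebra_simps)
qed

lemma hd_butlast: "2 \<le> length W \<Longrightarrow> hd (butlast W) = hd W"
  by (cases W) auto

lemma constant_if_Cons_butlast:
  assumes "b # butlast A = A"
  shows "x \<in> set A \<Longrightarrow> x = b"
  using assms
proof (induction A arbitrary: x)
  case (Cons y A)
  show ?case
  proof (cases A)
    case Nil
    then show ?thesis using Cons.prems by simp
  next
    case A: (Cons z B)
    then have "y = b" "y # butlast A = A" using Cons.prems by auto
    then show ?thesis using Cons by auto
  qed
qed simp

text \<open>If \<open>a # butlast A\<close> is \<open>A\<close> itself, then \<open>A\<close> is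
  constant and the reply by the other letter suffices. Otherwise both replies are legal, and if
  neither went below the value, \<open>excess_arith\<close> and \<open>optimal_structure\<close>
  would give \<open>A\<close> the excluded form.\<close>

lemma win_prob_less_if_not_core:
  fixes A :: "coin list"
  assumes n: "length A = n" "4 \<le> n" and not: "\<And>a V. V \<in> core a (n - 1) \<Longrightarrow> A \<noteq> V @ [a]"
  shows "\<exists>B\<in>strings n - {A}. win_prob A B < optimal_value n"
proof -
  define a where "a = hd A"
  obtain c where c: "c \<noteq> a" by (metis coin.distinct(1))
  have ne: "A \<noteq> []" "butlast A \<noteq> []" using n by (auto simp flip: length_greater_0_conv)
  define x :: int where "x = 2 ^ (n - 2)"
  have x: "0 < x" by (simp add: x_def)
  have str: "b # butlast A \<in> strings n" for b using n by (simp add: strings_def)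
  have cA: "c # butlast A \<noteq> A" using c a_def by (metis list.sel(1))
  show ?thesis
  proof (cases "a # butlast A = A")
    case True
    have "z = a" if "z \<in> set A" for z using constant_if_Cons_butlast[OF True that] .
    then have all: "A ! i = a" if "i < n" for i using that n by auto
    \<comment> \<open>The letter \<open>c\<close> does not occur in \<open>A\<close>, so only the
      term \<open>- weight (borders W)\<close> of the excess remains.\<close>
    have ex: "excess c W \<le> 0" if "W = A \<or> W = butlast A" for W
    proof -
      have l: "W \<noteq> []" "length W \<le> n" using that ne n by auto
      have nth: "W ! i = a" if "i < length W" for i
        using that \<open>W = A \<or> W = butlast A\<close> all n by (auto simp: nth_butlast)
      have "borders_after c W = {}"
        using nth c by (auto simp: borders_after_def borders_def)
      moreover have "last W \<noteq> c" using nth[of "length W - 1"] l c by (simp add: last_conv_nth)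
      ultimately show ?thesis using l weight_nonneg by (simp add: excess_eq)
    qed
    have "excess c (butlast A) * (2 * x + 1) + excess c A * (x + 1) \<le> 0"
      using ex x by (intro add_nonpos_nonpos mult_nonpos_nonneg) auto
    then have "win_prob A (c # butlast A) < optimal_value n"
      using win_prob_Cons_butlast(1)[OF n(1) _ cA] n x unfolding x_def[symmetric] by simp
    then show ?thesis using str cA by auto
  next
    case False
    show ?thesis
    proof (rule ccontr)
      assume no: "\<not> ?thesis"
      define u v where "u = excess a (butlast A)" and "v = excess a A"
      have uc: "excess c (butlast A) = 1 - u" and vc: "excess c A = 1 - v"
        using excess_add[OF c ne(2)] excess_add[OF c ne(1)] by (simp_all add: u_def v_def)
      have "\<not> win_prob A (a # butlast A) < optimal_value n"
        using no str False by auto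
      then have 1: "x \<le> u * (2 * x + 1) + v * (x + 1)"
        using win_prob_Cons_butlast(1)[OF n(1) _ False] n by (simp add: u_def v_def x_def)
      have "\<not> win_prob A (c # butlast A) < optimal_value n"
        using no str cA by auto
      then have 2: "x \<le> (1 - u) * (2 * x + 1) + (1 - v) * (x + 1)"
        using win_prob_Cons_butlast(1)[OF n(1) _ cA] n uc vc by (simp add: x_def)
      have "even u" "even v"
        using even_excess_hd[of A] even_excess_hd[of "butlast A"] n
        by (simp_all add: u_def v_def a_def hd_butlast)
      moreover have "- x < u" "u \<le> x"
        using excess_gt[OF ne(2), of a] excess_le[OF ne(2), of a] n
        by (simp_all add: u_def x_def numeral_2_eq_2)
      ultimately have "0 \<le> u \<and> v = 2 - 2 * u" using 1 2 by (intro excess_arith)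
      then show False
        using optimal_structure[OF n a_def[symmetric]] not unfolding u_def v_def by blast
    qed
  qed
qed

text \<open>A longer border of \<open>V @ [a]\<close>, without its last letter, is a border of
  \<open>V\<close> and so has length 1. The longer border then has length 2 and ends in
  \<open>V ! 1\<close>, which is not \<open>a\<close>.\<close>

lemma borders_core_snoc:
  assumes V: "V \<in> core a (n - 1)" and n: "4 \<le> n"
  shows "borders (V @ [a]) = {1}"
proof -
  have l: "length V = n - 1" and bV: "borders V = {1}"
    and nth: "V ! 0 = a" "V ! 1 \<noteq> a" "V ! (n - 2) = a"
    using V by (auto simp: core_def numeral_2_eq_2)
  have "k = 1" if k: "k \<in> borders (V @ [a])" for k
  proof (rule ccontr)
    assume "k \<noteq> 1"
    then have k2: "2 \<le> k" "k < n" using k l by (auto simp: borders_def)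
    have "k - 1 \<in> borders V"
    proof (rule bordersI)
      fix i assume i: "i < k - 1"
      have "(V @ [a]) ! (n - k + i) = (V @ [a]) ! i"
        using borders_nth[OF k, of i] i l n by simp
      moreover have "n - k + i < n - 1" "i < n - 1" "length V - (k - 1) + i = n - k + i"
        using i k2 l by auto
      ultimately show "V ! (length V - (k - 1) + i) = V ! i"
        using l by (simp add: nth_append)
    qed (use k2 l in auto)
    then have "k = 2" using bV by auto
    moreover have "n - 2 + 1 = length V" using l n by simp
    ultimately have "(V @ [a]) ! length V = (V @ [a]) ! 1"
      using borders_nth[OF k, of 1] l n by simp
    moreover have "1 < length V" using l n by simp
    ultimately show False using nth by (simp add: nth_append)
  qed
  moreover have "1 \<in> borders (V @ [a])"
    by (rule bordersI) (use l n nth in \<open>auto simp: nth_append\<close>)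
  ultimately show ?thesis by blast
qed

lemma core_excess:
  fixes V :: "coin list"
  assumes V: "V \<in> core a (n - 1)" and n: "4 \<le> n"
  shows "excess a V = 0" "excess a (V @ [a]) = 2"
proof -
  have l: "length V = n - 1" and bV: "borders V = {1}"
    and nth: "V ! (n - 3) \<noteq> a" "V ! (n - 2) = a"
    using V by (auto simp: core_def numeral_2_eq_2 numeral_3_eq_3)
  have ne: "V \<noteq> []" using l n by auto
  have "borders_after a V = {}" using bV nth l by (auto simp: borders_after_def numeral_3_eq_3)
  moreover have "last V = a" using nth l ne by (simp add: last_conv_nth numeral_2_eq_2)
  ultimately show "excess a V = 0" using ne bV by (simp add: excess_eq weight_def)
  have "borders_after a (V @ [a]) = {1}"
    using borders_core_snoc[OF V n] nth l n
    by (auto simp: borders_after_def nth_append numeral_2_eq_2)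
  then show "excess a (V @ [a]) = 2"
    using borders_core_snoc[OF V n] by (simp add: excess_eq weight_def)
qed

text \<open>A reply not of the form \<open>b # V\<close> misses the overlap of length
  \<open>n - 1\<close>, so \<open>corr B A < x\<close> and the side of \<open>A\<close> in the odds
  is at least \<open>x + 1\<close>; the other side is at most \<open>corr A A = 2 * x + 1\<close>.
  Replies \<open>b # V\<close> are settled by the known excesses.\<close>

lemma win_prob_ge_core:
  assumes V: "V \<in> core a (n - 1)" and n: "4 \<le> n" and B: "length B = n" "B \<noteq> V @ [a]"
  shows "optimal_value n \<le> win_prob (V @ [a]) B"
proof -
  define A where "A = V @ [a]"
  define x :: int where "x = 2 ^ (n - 2)"
  have x: "4 \<le> x" using n power_increasing[of 2 "n - 2" "2::int"] by (simp add: x_def)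
  have l: "length A = n" using V n by (simp add: A_def core_def)
  have x2: "2 ^ (n - 1) = 2 * x"
  proof -
    have "n - 1 = Suc (n - 2)" using n by simp
    then show ?thesis by (simp add: x_def)
  qed
  have neq: "A \<noteq> B" using B by (simp add: A_def)
  have "\<not> win_prob A B < optimal_value n"
  proof (cases "B = hd B # V")
    case False
    have "corr B A < 2 ^ (n - 2)" unfolding corr_def
    proof (rule weight_less)
      fix k assume k: "k \<in> overlaps B A"
      have "k \<noteq> n" using k B l by (auto simp: overlaps_def A_def)
      moreover have "k \<noteq> n - 1"
      proof
        assume "k = n - 1"
        then have "drop 1 B = V" using k B l n by (auto simp: overlaps_def A_def)
        then show False using False B n by (cases B) auto
      qed
      ultimately show "0 < k \<and> k \<le> n - 2" using k B by (auto simp: overlaps_def)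
    qed
    moreover have "2 * x \<le> corr B B" using corr_self_ge[of B] B n x2 by fastforce
    ultimately have D: "x + 1 \<le> corr B B - corr B A" by (simp add: x_def)
    have "A \<noteq> []" by (simp add: A_def)
    have "corr A A = 2 * x + 1"
      using corr_self[OF \<open>A \<noteq> []\<close>, unfolded l x2] borders_core_snoc[OF V n, folded A_def]
      by (simp add: weight_def)
    then have Q: "corr A A - corr A B \<le> 2 * x + 1" using corr_nonneg[of A B] by simp
    have "(corr A A - corr A B) * (x + 1) \<le> (2 * x + 1) * (x + 1)"
      using Q x by (intro mult_right_mono) auto
    also have "\<dots> \<le> (corr B B - corr B A) * (2 * x + 1)"
      using D x by (subst mult.commute) (intro mult_right_mono, auto)
    finally show ?thesis
      using win_prob_compare(1)[OF l B(1) neq] by (simp add: x_def)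
  next
    case True
    define b where "b = hd B"
    have b: "B = b # butlast A" using True by (simp add: A_def b_def)
    have ne: "b # butlast A \<noteq> A" using neq b by simp
    have e: "excess a (butlast A) = 0" "excess a A = 2"
      using core_excess[OF V n] by (simp_all add: A_def)
    have "x \<le> excess b (butlast A) * (2 * x + 1) + excess b A * (x + 1)"
    proof (cases "b = a")
      case True
      then show ?thesis using e x by simp
    next
      case False
      have "butlast A \<noteq> []" "A \<noteq> []" using l n by (auto simp flip: length_greater_0_conv)
      then have "excess b (butlast A) = 1" "excess b A = -1"
        using excess_add[OF False] e by fastforce+
      then show ?thesis by simp
    qed
    then show ?thesis
      using win_prob_Cons_butlast(1)[OF l _ ne] n b by (simp add: x_def)
  qed
  then show ?thesis by (simp add: A_def)
qed

text \<open>The reply by the other letter has excesses 1 and -1, so the odds are exactly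
  \<open>x + 1 : 2x + 1\<close> and the lower bound is attained.\<close>

lemma win_prob_eq_core:
  assumes V: "V \<in> core a (n - 1)" and n: "4 \<le> n" and c: "c \<noteq> a"
  shows "c # V \<in> strings n - {V @ [a]}" "win_prob (V @ [a]) (c # V) = optimal_value n"
proof -
  have l: "length V = n - 1" and V0: "V ! 0 = a" using V by (auto simp: core_def)
  have ne: "V \<noteq> []" using l n by auto
  have neq: "c # V \<noteq> V @ [a]" using V0 ne c by (cases V) auto
  then show "c # V \<in> strings n - {V @ [a]}" using l n by (auto simp: strings_def)
  have "excess c V = 1" "excess c (V @ [a]) = -1"
    using excess_add[OF c ne] excess_add[OF c, of "V @ [a]"] core_excess[OF V n] by simp_all
  then show "win_prob (V @ [a]) (c # V) = optimal_value n"
    using win_prob_Cons_butlast(2)[of "V @ [a]" n c] neq l n by simp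
qed

lemma core_nonempty:
  assumes "3 \<le> N"
  shows "core (a :: coin) N \<noteq> {}"
proof -
  obtain c where c: "c \<noteq> a" by (metis coin.distinct(1))
  define W where "W = a # replicate (N - 2) c @ [a]"
  have l: "length W = N" using assms by (simp add: W_def)
  have nth: "W ! i = c" if "0 < i" "i < N - 1" for i
    using that by (auto simp: W_def nth_Cons' nth_append)
  have ends: "W ! 0 = a" "W ! (N - 1) = a"
    using assms by (auto simp: W_def nth_Cons' nth_append)
  have "k = 1" if k: "k \<in> borders W" for k
  proof (rule ccontr)
    assume "k \<noteq> 1"
    then have "1 < k" "k < N" using k l by (auto simp: borders_def)
    then show False using borders_nth[OF k, of 0] nth[of "N - k"] ends l c by simp
  qed
  moreover have "1 \<in> borders W"
    by (rule bordersI) (use l assms ends in auto)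
  ultimately have "borders W = {1}" by blast
  moreover have "W ! 1 \<noteq> a" "W ! (N - 2) \<noteq> a" using nth[of 1] nth[of "N - 2"] assms c by auto
  ultimately have "W \<in> core a N" using l ends by (simp add: core_def)
  then show ?thesis by blast
qed

text \<open>Core words followed by \<open>a\<close> guarantee exactly
  \<open>optimal_value n\<close>, all other words less; since core words exist, this value is the
  maximum.\<close>

lemma optimal_strategy_iff:
  assumes n: "4 \<le> n"
  shows "optimal_strategy n A \<longleftrightarrow> (\<exists>a. \<exists>V\<in>core a (n - 1). A = V @ [a])"
proof -
  have fin: "finite (win_prob A ` (strings n - {A}))" for A
    using finite_strings by simp
  have g_le: "guaranteed_prob n A \<le> win_prob A B" if "B \<in> strings n - {A}" for A B
    unfolding guaranteed_prob_def using fin that by (intro Min_le) auto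
  have g_core: "guaranteed_prob n (V @ [a]) = optimal_value n" if V: "V \<in> core a (n - 1)" for a V
  proof (rule antisym)
    obtain c where c: "c \<noteq> a" by (metis coin.distinct(1))
    show "guaranteed_prob n (V @ [a]) \<le> optimal_value n"
      using g_le[OF win_prob_eq_core(1)[OF V n c]] win_prob_eq_core(2)[OF V n c] by simp
    have "strings n - {V @ [a]} \<noteq> {}" using win_prob_eq_core(1)[OF V n c] by blast
    then show "optimal_value n \<le> guaranteed_prob n (V @ [a])"
      unfolding guaranteed_prob_def
      using win_prob_ge_core[OF V n] fin by (auto simp: strings_def)
  qed
  have g_other: "guaranteed_prob n A < optimal_value n"
    if A: "A \<in> strings n" "\<not> (\<exists>a. \<exists>V\<in>core a (n - 1). A = V @ [a])" for A
  proof -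
    have "length A = n" using A by (simp add: strings_def)
    then obtain B where "B \<in> strings n - {A}" "win_prob A B < optimal_value n"
      using win_prob_less_if_not_core[OF _ n, of A] A(2) by blast
    then show ?thesis using g_le[of B A] by simp
  qed
  have str: "V @ [a] \<in> strings n" if "V \<in> core a (n - 1)" for a V
    using that n by (auto simp: strings_def core_def)
  show ?thesis
  proof
    assume opt: "optimal_strategy n A"
    obtain V where V: "V \<in> core Heads (n - 1)" using core_nonempty[of "n - 1" Heads] n by fastforce
    have "optimal_value n \<le> guaranteed_prob n A"
      using opt str[OF V] g_core[OF V] by (auto simp: optimal_strategy_def)
    then show "\<exists>a. \<exists>V\<in>core a (n - 1). A = V @ [a]"
      using g_other[of A] opt unfolding optimal_strategy_def by fastforce
  next
    assume "\<exists>a. \<exists>V\<in>core a (n - 1). A = V @ [a]"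
    then obtain a V where V: "V \<in> core a (n - 1)" "A = V @ [a]" by blast
    have "guaranteed_prob n A' \<le> optimal_value n" if "A' \<in> strings n" for A'
      using g_other[OF that] g_core by force
    then show "optimal_strategy n A"
      using V str g_core by (auto simp: optimal_strategy_def)
  qed
qed

section \<open>Counting optimal strategies\<close>

lemma num_optimal_eq:
  assumes "4 \<le> n"
  shows "num_optimal n = card (core Heads (n - 1)) + card (core Tails (n - 1))"
proof -
  have fin: "finite (core (a :: coin) N)" for a N
    by (rule finite_subset[OF _ finite_coin_lists[of N]]) (auto simp: core_def)
  have "{A. optimal_strategy n A} =
    (\<lambda>V. V @ [Heads]) ` core Heads (n - 1) \<union> (\<lambda>V. V @ [Tails]) ` core Tails (n - 1)"
    unfolding optimal_strategy_iff[OF assms] by (auto, metis (full_types) coin.exhaust imageI)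
  then show ?thesis
    unfolding num_optimal_def by (simp, subst card_Un_disjoint) (auto simp: fin card_image inj_on_def)
qed

text \<open>The two occurrences of the border at the ends of \<open>X\<close> share
  \<open>2 * k - length X\<close> letters, which form both a suffix and a prefix of the
  border.\<close>

lemma borders_overlap:
  assumes k: "k \<in> borders X" and "length X < 2 * k"
  shows "2 * k - length X \<in> borders X"
proof (rule bordersI)
  have kl: "k < length X" using borders_bounds[OF k] by simp
  show "0 < 2 * k - length X" "2 * k - length X < length X" using assms(2) kl by auto
  fix i assume i: "i < 2 * k - length X"
  have "X ! (length X - (2 * k - length X) + i) = X ! (length X - k + (length X - k + i))"
    using kl i by (auto intro!: arg_cong[of _ _ "(!) X"])
  also have "\<dots> = X ! (length X - k + i)" using kl i by (intro borders_nth[OF k]) simp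
  also have "\<dots> = X ! i" using i kl by (intro borders_nth[OF k]) simp
  finally show "X ! (length X - (2 * k - length X) + i) = X ! i" .
qed

text \<open>The last \<open>j\<close> letters of \<open>X\<close> repeat its first \<open>j\<close>,
  so short suffixes of \<open>X\<close> are suffixes of \<open>take j X\<close>.\<close>

lemma borders_take:
  assumes j: "j \<in> borders X"
  shows "borders (take j X) = {k \<in> borders X. k < j}"
proof -
  have jl: "j < length X" using borders_bounds[OF j] by simp
  have eq: "X ! (length X - k + i) = X ! (j - k + i)" if "k < j" "i < k" for i k
    using borders_nth[OF j, of "j - k + i"] that jl by simp
  show ?thesis
  proof (intro equalityI subsetI)
    fix k assume k: "k \<in> borders (take j X)"
    then have kj: "0 < k" "k < j" using jl by (auto simp: borders_def)
    have "k \<in> borders X"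
    proof (rule bordersI)
      fix i assume i: "i < k"
      show "X ! (length X - k + i) = X ! i"
        using borders_nth[OF k i] eq[OF kj(2) i] kj i jl by simp
    qed (use kj jl in auto)
    with kj show "k \<in> {k \<in> borders X. k < j}" by simp
  next
    fix k assume "k \<in> {k \<in> borders X. k < j}"
    then have k: "k \<in> borders X" "0 < k" "k < j" using borders_bounds by auto
    show "k \<in> borders (take j X)"
    proof (rule bordersI)
      fix i assume i: "i < k"
      show "take j X ! (length (take j X) - k + i) = take j X ! i"
        using borders_nth[OF k(1) i] eq[OF k(3) i] k i jl by simp
    qed (use k jl in auto)
  qed
qed

section \<open>Inserting letters into the middle of a core word\<close>

definition core_upto :: "'a \<Rightarrow> nat \<Rightarrow> nat \<Rightarrow> 'a list set" where
  "core_upto a m N = {X. length X = N \<and> X ! 0 = a \<and> X ! 1 \<noteq> a \<and> X ! (N - 2) \<noteq> a \<and> X ! (N - 1) = a \<and>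
    (\<forall>k\<in>borders X. 2 \<le> k \<longrightarrow> m < k)}"

text \<open>Consider the least border above 1. If it exceeded \<open>m + 1\<close>, its two
  occurrences would share at least 2 letters, because \<open>N \<le> 2 * m + 2\<close>, and these
  would form a smaller such border.\<close>

lemma core_upto_border:
  assumes "X \<in> core_upto a m N" "N \<le> 2 * m + 2" "k \<in> borders X" "2 \<le> k"
  shows "Suc m \<in> borders X"
proof -
  define k where "k = (LEAST k. k \<in> borders X \<and> 2 \<le> k)"
  have k: "k \<in> borders X" "2 \<le> k" unfolding k_def using LeastI[of "\<lambda>k. k \<in> borders X \<and> 2 \<le> k"] assms by auto
  have least: "\<not> j < k" if "j \<in> borders X" "2 \<le> j" for j
    unfolding k_def using not_less_Least that by blast
  have N: "length X = N" "m < k" using assms(1) k by (auto simp: core_upto_def)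
  have kN: "k < N" using borders_bounds[OF k(1)] N by simp
  have "k = Suc m"
  proof (rule ccontr)
    assume "k \<noteq> Suc m"
    then have "N < 2 * k" "2 \<le> 2 * k - N" "2 * k - N < k" using N kN assms(2) by auto
    then show False using borders_overlap[OF k(1)] least N by auto
  qed
  then show ?thesis using k by simp
qed

lemma one_mem_bordersI: "length X = N \<Longrightarrow> 2 \<le> N \<Longrightarrow> X ! 0 = a \<Longrightarrow> X ! (N - 1) = a \<Longrightarrow> 1 \<in> borders X"
  by (rule bordersI) auto

lemma core_eq_core_upto:
  assumes "2 \<le> N"
  shows "core a N = {X \<in> core_upto a m N. \<forall>k\<in>borders X. k < 2}"
proof -
  have "borders X = {1} \<longleftrightarrow> (\<forall>k\<in>borders X. k < 2)"
    if "length X = N" "X ! 0 = a" "X ! (N - 1) = a" for X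
  proof -
    have "1 \<in> borders X" using one_mem_bordersI that assms by metis
    moreover have "0 < k" if "k \<in> borders X" for k using borders_bounds[OF that] by simp
    ultimately show ?thesis by (force simp: less_2_cases_iff)
  qed
  moreover have "\<forall>k\<in>borders X. 2 \<le> k \<longrightarrow> m < k" if "\<forall>k\<in>borders X. k < 2" for X
    using that by (meson not_le)
  ultimately have "X \<in> core a N \<longleftrightarrow> X \<in> core_upto a m N \<and> (\<forall>k\<in>borders X. k < 2)" for X
    unfolding core_def core_upto_def mem_Collect_eq by metis
  then show ?thesis by blast
qed

text \<open>At length \<open>2 * m\<close> the occurrences of a border \<open>m + 1\<close> would
  share 2 letters and give the forbidden border 2.\<close>

lemma core_upto_double:
  assumes "2 \<le> m"
  shows "core_upto a m (2 * m) = core a (2 * m)"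
proof -
  have "k < 2" if X: "X \<in> core_upto a m (2 * m)" and k: "k \<in> borders X" for X k
  proof (rule ccontr)
    assume "\<not> k < 2"
    then have "Suc m \<in> borders X" using core_upto_border[OF X _ k] by simp
    moreover have "length X = 2 * m" using X by (simp add: core_upto_def)
    ultimately have "2 \<in> borders X" using borders_overlap[of "Suc m" X] by simp
    then show False using X assms by (auto simp: core_upto_def)
  qed
  then show ?thesis using core_eq_core_upto[of "2 * m" a m] assms by auto
qed

lemma core_upto_decomp:
  assumes "2 \<le> N" "N \<le> 2 * m + 2" "2 \<le> m"
  shows "core_upto a m N = core a N \<union> {X \<in> core_upto a m N. Suc m \<in> borders X}"
    "core a N \<inter> {X \<in> core_upto a m N. Suc m \<in> borders X} = {}"
proof -
  have "k < 2" if "X \<in> core_upto a m N" "Suc m \<notin> borders X" "k \<in> borders X" for X k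
    using core_upto_border[OF that(1) assms(2) that(3)] that(2) by (meson not_le)
  then show "core_upto a m N = core a N \<union> {X \<in> core_upto a m N. Suc m \<in> borders X}"
    unfolding core_eq_core_upto[OF assms(1), of a m] by blast
  show "core a N \<inter> {X \<in> core_upto a m N. Suc m \<in> borders X} = {}"
  proof -
    have "Suc m \<notin> borders X" if "X \<in> core a N" for X
      using that assms(3) unfolding core_def by simp
    then show ?thesis by blast
  qed
qed

text \<open>Two copies of the border \<open>W\<close> of length \<open>m + 1\<close> cover the word
  and share \<open>2 - r\<close> letters, so \<open>W\<close> determines it. For
  \<open>r = 1\<close> the shared letter is the \<open>a\<close> with which \<open>W\<close> begins
  and ends.\<close>

lemma bij_betw_take_core:
  assumes m: "2 \<le> m" and r: "r = 1 \<or> r = 2"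
  shows "bij_betw (take (Suc m)) {X \<in> core_upto a m (2 * m + r). Suc m \<in> borders X} (core a (Suc m))"
proof (rule bij_betw_byWitness[where f' = "\<lambda>W. take (m + r - 1) W @ W"])
  let ?N = "2 * m + r"
  let ?S = "{X \<in> core_upto a m ?N. Suc m \<in> borders X}"
  have idx: "?N - Suc m = m + r - 1" "m + r - 1 \<le> Suc m" using r m by auto
  show "\<forall>X\<in>?S. take (m + r - 1) (take (Suc m) X) @ take (Suc m) X = X"
  proof
    fix X assume X: "X \<in> ?S"
    then have "take (Suc m) X = drop (m + r - 1) X"
      using idx(1) by (auto simp: borders_def core_upto_def)
    moreover have "take (m + r - 1) (take (Suc m) X) = take (m + r - 1) X"
      using idx(2) by (simp add: min_def)
    ultimately show "take (m + r - 1) (take (Suc m) X) @ take (Suc m) X = X"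
      by (metis append_take_drop_id)
  qed
  have take_W: "take (Suc m) (take (m + r - 1) W @ W) = W" if W: "W \<in> core a (Suc m)" for W
    using r
  proof
    assume "r = 1"
    have "W = take m W @ [a]"
      using W take_Suc_conv_app_nth[of m W] by (simp add: core_def)
    moreover have "take 1 W = [a]" using W by (cases W) (auto simp: core_def)
    ultimately show ?thesis using W \<open>r = 1\<close> by (simp add: core_def)
  qed (use W in \<open>simp add: core_def\<close>)
  then show "\<forall>W\<in>core a (Suc m). take (Suc m) (take (m + r - 1) W @ W) = W" by blast
  show "take (Suc m) ` ?S \<subseteq> core a (Suc m)"
  proof (rule image_subsetI)
    fix X assume X: "X \<in> ?S"
    then have l: "length X = ?N" and nth: "X ! 0 = a" "X ! 1 \<noteq> a" "X ! (?N - 2) \<noteq> a" "X ! (?N - 1) = a"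
      and bo: "\<And>k. k \<in> borders X \<Longrightarrow> 2 \<le> k \<Longrightarrow> m < k" and bm: "Suc m \<in> borders X"
      by (auto simp: core_upto_def)
    have i: "length X - Suc m + (m - 1) = ?N - 2" "length X - Suc m + m = ?N - 1" "m - 1 < Suc m"
      using l m r by auto
    have "X ! (m - 1) \<noteq> a" "X ! m = a"
      using borders_nth[OF bm i(3)] borders_nth[OF bm lessI] nth(3,4) unfolding i(1,2) by simp_all
    moreover have "borders (take (Suc m) X) = {1}"
    proof -
      have "1 \<in> borders X" using one_mem_bordersI[OF l _ nth(1,4)] m by simp
      moreover have "k = 1" if "k \<in> borders X" "k < Suc m" for k
        using bo[OF that(1)] borders_bounds[OF that(1)] that(2) by (cases "2 \<le> k") auto
      moreover have "1 < Suc m" using m by simp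
      ultimately show ?thesis unfolding borders_take[OF bm] by blast
    qed
    moreover have "length (take (Suc m) X) = Suc m" using l m by simp
    moreover have "take (Suc m) X ! i = X ! i" if "i \<le> m" for i using that by simp
    moreover have "Suc m - 2 = m - 1" "1 \<le> m" using m by simp_all
    ultimately show "take (Suc m) X \<in> core a (Suc m)"
      using nth(1,2) unfolding core_def by simp
  qed
  show "(\<lambda>W. take (m + r - 1) W @ W) ` core a (Suc m) \<subseteq> ?S"
  proof (rule image_subsetI)
    fix W assume W: "W \<in> core a (Suc m)"
    define X where "X = take (m + r - 1) W @ W"
    have lW: "length W = Suc m" and nthW: "W ! 0 = a" "W ! 1 \<noteq> a" "W ! (m - 1) \<noteq> a" "W ! m = a"
      and bW: "borders W = {1}" using W by (auto simp: core_def)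
    have l: "length X = ?N" using lW idx r by (auto simp: X_def)
    have tX: "take (Suc m) X = W" using take_W[OF W] by (simp add: X_def)
    have dX: "drop (m + r - 1) X = W" using lW idx by (simp add: X_def)
    have bm: "Suc m \<in> borders X"
      using tX dX l idx m by (auto simp: borders_def)
    have "X ! 0 = a" "X ! 1 \<noteq> a"
      using nth_take[of 0 "Suc m" X] nth_take[of 1 "Suc m" X] nthW m unfolding tX by simp_all
    moreover have "X ! (?N - 2) = W ! (m - 1)" "X ! (?N - 1) = W ! m"
      using lW r m by (auto simp: X_def nth_append)
    moreover have "m < k" if k: "k \<in> borders X" "2 \<le> k" for k
    proof (rule ccontr)
      assume "\<not> m < k"
      then have "k \<in> borders W" using borders_take[OF bm] k tX by simp
      then show False using bW k by simp
    qed
    ultimately show "take (m + r - 1) W @ W \<in> ?S"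
      using l bm nthW unfolding X_def[symmetric] by (simp add: core_upto_def)
  qed
qed

text \<open>At length at least \<open>2 * m\<close>, membership in \<open>core_upto a m\<close>
  restricts only the first and the last \<open>m\<close> letters; these are the admissible pairs of
  ends.\<close>

definition core_halves :: "'a \<Rightarrow> nat \<Rightarrow> ('a list \<times> 'a list) set" where
  "core_halves a m = {(P, Q). length P = m \<and> length Q = m \<and> P ! 0 = a \<and> P ! 1 \<noteq> a \<and>
    Q ! (m - 2) \<noteq> a \<and> Q ! (m - 1) = a \<and> (\<forall>k. 2 \<le> k \<longrightarrow> k \<le> m \<longrightarrow> drop (m - k) Q \<noteq> take k P)}"

lemma append_mem_core_upto_iff:
  assumes "2 \<le> m" "length P = m" "length Q = m" "length U = r"
  shows "P @ U @ Q \<in> core_upto a m (2 * m + r) \<longleftrightarrow> (P, Q) \<in> core_halves a m"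
proof -
  let ?X = "P @ U @ Q"
  have "(\<forall>k\<in>borders ?X. 2 \<le> k \<longrightarrow> m < k) \<longleftrightarrow> (\<forall>k. 2 \<le> k \<longrightarrow> k \<le> m \<longrightarrow> k \<notin> borders ?X)"
    by (meson not_le)
  also have "\<dots> \<longleftrightarrow> (\<forall>k. 2 \<le> k \<longrightarrow> k \<le> m \<longrightarrow> drop (m - k) Q \<noteq> take k P)"
  proof (intro all_cong1 imp_cong refl)
    fix k :: nat assume k: "2 \<le> k" "k \<le> m"
    have "drop (length ?X - k) ?X = drop (m - k) Q" using k assms by simp
    moreover have "take k ?X = take k P" using k assms by simp
    ultimately show "k \<notin> borders ?X \<longleftrightarrow> drop (m - k) Q \<noteq> take k P"
      using k assms by (simp add: borders_def)
  qed
  finally have b: "(\<forall>k\<in>borders ?X. 2 \<le> k \<longrightarrow> m < k) \<longleftrightarrow>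
    (\<forall>k. 2 \<le> k \<longrightarrow> k \<le> m \<longrightarrow> drop (m - k) Q \<noteq> take k P)" .
  have "2 * m + r - 2 = m + r + (m - 2)" "2 * m + r - 1 = m + r + (m - 1)" using assms by auto
  moreover have "?X ! (m + r + i) = Q ! i" for i using assms by (simp add: nth_append)
  moreover have "?X ! 0 = P ! 0" "?X ! 1 = P ! 1" using assms by (simp_all add: nth_append)
  ultimately have "?X ! 0 = P ! 0" "?X ! 1 = P ! 1" "?X ! (2 * m + r - 2) = Q ! (m - 2)"
    "?X ! (2 * m + r - 1) = Q ! (m - 1)"
    by (simp_all only:)
  then show ?thesis
    unfolding core_upto_def core_halves_def using b assms by simp
qed

text \<open>Each admissible pair of ends leaves the \<open>r\<close> letters in the middle
  free.\<close>

lemma card_core_upto: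
  assumes "2 \<le> m"
  shows "card (core_upto (a :: coin) m (2 * m + r)) = 2 ^ r * card (core_halves a m)"
proof -
  let ?L = "{U :: coin list. length U = r}"
  have "bij_betw (\<lambda>((P, Q), U). P @ U @ Q) (core_halves a m \<times> ?L) (core_upto a m (2 * m + r))"
    unfolding bij_betw_def
  proof
    show "inj_on (\<lambda>((P, Q), U). P @ U @ Q) (core_halves a m \<times> ?L)"
      by (auto simp: inj_on_def core_halves_def)
    show "(\<lambda>((P, Q), U). P @ U @ Q) ` (core_halves a m \<times> ?L) = core_upto a m (2 * m + r)"
      (is "?f ` ?S = ?T")
    proof (intro equalityI subsetI)
      fix X assume "X \<in> ?f ` ?S"
      then obtain P Q U where "(P, Q) \<in> core_halves a m" "length U = r" "X = P @ U @ Q" by auto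
      then show "X \<in> ?T" using append_mem_core_upto_iff[OF assms, of P Q U r a]
        by (auto simp: core_halves_def)
    next
      fix X assume X: "X \<in> ?T"
      then have l: "length X = 2 * m + r" by (simp add: core_upto_def)
      define P U Q where "P = take m X" and "U = take r (drop m X)" and "Q = drop (m + r) X"
      have X_eq: "X = P @ U @ Q"
        unfolding P_def U_def Q_def by (metis add.commute append_take_drop_id drop_drop)
      have len: "length P = m" "length U = r" "length Q = m"
        using l by (auto simp: P_def U_def Q_def)
      then have "(P, Q) \<in> core_halves a m"
        using append_mem_core_upto_iff[OF assms len(1,3,2), of a] X X_eq by simp
      then show "X \<in> ?f ` ?S" using len X_eq by force
    qed
  qed
  then have "card (core_upto a m (2 * m + r)) = card (core_halves a m \<times> ?L)"
    by (simp add: bij_betw_same_card)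
  also have "card ?L = 2 ^ r"
  proof -
    have "card (UNIV :: coin set) = 2" "finite (UNIV :: coin set)" by (simp_all add: UNIV_coin)
    then show ?thesis using card_lists_length_eq[of "UNIV :: coin set" r] by simp
  qed
  then have "card (core_halves a m \<times> ?L) = 2 ^ r * card (core_halves a m)"
    by (simp add: card_cartesian_product)
  finally show ?thesis .
qed

text \<open>\<open>core_upto a m (2 * m + r)\<close> is counted twice: free middle letters give
  \<open>2 ^ r\<close> times its size at \<open>r = 0\<close>, where it is a core, and splitting off
  the words with border \<open>m + 1\<close> gives the left side.\<close>

lemma card_core_rec:
  assumes m: "2 \<le> m" and r: "r = 1 \<or> r = 2"
  shows "card (core (a :: coin) (2 * m + r)) + card (core a (Suc m)) = 2 ^ r * card (core a (2 * m))"
proof -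
  let ?S = "{X \<in> core_upto a m (2 * m + r). Suc m \<in> borders X}"
  have fin: "finite (core_upto a m (2 * m + r))"
    by (rule finite_subset[OF _ finite_coin_lists[of "2 * m + r"]]) (auto simp: core_upto_def)
  have N: "2 \<le> 2 * m + r" "2 * m + r \<le> 2 * m + 2" using m r by auto
  note decomp = core_upto_decomp[OF N m, of a]
  have "card (core_upto a m (2 * m + r)) = card (core a (2 * m + r)) + card ?S"
    by (metis (no_types, lifting) card_Un_disjoint decomp fin finite_Un)
  then show ?thesis
    using bij_betw_same_card[OF bij_betw_take_core[OF m r, of a]] card_core_upto[OF m, of a r]
      card_core_upto[OF m, of a 0] core_upto_double[OF m, of a] by simp
qed

lemma coin_neq_imp_eq: "x \<noteq> a \<Longrightarrow> y \<noteq> a \<Longrightarrow> x = y" for a x y :: coin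
  by (cases x; cases y; cases a) auto

lemma card_core_initial:
  assumes "N = 3 \<or> N = 4"
  shows "card (core (a :: coin) N) = 1"
proof -
  obtain W where W: "W \<in> core a N" using core_nonempty[of N a] assms by auto
  have "W' = W" if W': "W' \<in> core a N" for W'
  proof (rule nth_equalityI)
    show "length W' = length W" using W W' by (simp add: core_def)
    fix i assume "i < length W'"
    moreover have "length W' = N" using W' by (simp add: core_def)
    ultimately have "i = 0 \<or> i = 1 \<or> i = N - 2 \<or> i = N - 1" using assms by presburger
    moreover have "W' ! 0 = W ! 0" "W' ! (N - 1) = W ! (N - 1)" using W W' by (simp_all add: core_def)
    moreover have "W' ! 1 = W ! 1" "W' ! (N - 2) = W ! (N - 2)"
      using W W' by (auto simp: core_def intro: coin_neq_imp_eq)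
    ultimately show "W' ! i = W ! i" by auto
  qed
  then have "core a N = {W}" using W by blast
  then show ?thesis by simp
qed

text \<open>The cases \<open>r = 1\<close> and \<open>r = 2\<close> of \<open>card_core_rec\<close>,
  summed over both letters. Indices shift by 1 because an optimal string is a core word with one
  letter appended.\<close>

lemma num_optimal_rec:
  assumes "2 \<le> m"
  shows "num_optimal (2 * m + 2) + num_optimal (m + 2) = 2 * num_optimal (2 * m + 1)"
    "num_optimal (2 * m + 3) + num_optimal (m + 2) = 4 * num_optimal (2 * m + 1)"
proof -
  let ?d = "\<lambda>N. card (core Heads N) + card (core Tails N)"
  have opt: "num_optimal (Suc N) = ?d N" if "3 \<le> N" for N
    using num_optimal_eq[of "Suc N"] that by simp
  have rec: "?d (2 * m + r) + ?d (Suc m) = 2 ^ r * ?d (2 * m)" if "r = 1 \<or> r = 2" for r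
    using card_core_rec[OF assms that, of Heads] card_core_rec[OF assms that, of Tails]
    by (simp add: distrib_left)
  show "num_optimal (2 * m + 2) + num_optimal (m + 2) = 2 * num_optimal (2 * m + 1)"
    using rec[of 1] opt[of "2 * m + 1"] opt[of "2 * m"] opt[of "Suc m"] assms by simp
  show "num_optimal (2 * m + 3) + num_optimal (m + 2) = 4 * num_optimal (2 * m + 1)"
    using rec[of 2] opt[of "2 * m + 2"] opt[of "2 * m"] opt[of "Suc m"] assms
    by (simp add: eval_nat_numeral)
qed

section \<open>Growth of the counts and the limit\<close>

lemma num_optimal_initial: "num_optimal 4 = 2" "num_optimal 5 = 2"
  by (simp_all add: num_optimal_eq card_core_initial)

text \<open>Dropping the term \<open>num_optimal (m + 2)\<close> from the recurrences bounds the
  growth by 4 between odd lengths and by 2 from an odd length to the next. The bound serves for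
  summability and for positivity of the limit.\<close>

lemma num_optimal_le: "real (num_optimal (n + 4)) / 2 ^ (n + 4) \<le> 1 / 8"
proof -
  have odd: "8 * num_optimal (2 * m + 5) \<le> 2 ^ (2 * m + 5)" for m
  proof (induction m)
    case 0
    then show ?case by (simp add: num_optimal_initial)
  next
    case (Suc m)
    have "num_optimal (2 * Suc m + 5) \<le> 4 * num_optimal (2 * m + 5)"
    proof -
      have "2 * (m + 2) + 3 = 2 * Suc m + 5" "2 * (m + 2) + 1 = 2 * m + 5" by simp_all
      note * = num_optimal_rec(2)[OF le_add2, of m, unfolded this]
      show ?thesis using * by linarith
    qed
    moreover have "(2::nat) ^ (2 * Suc m + 5) = 4 * 2 ^ (2 * m + 5)" by (simp add: power_add)
    ultimately show ?case using Suc by linarith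
  qed
  have even: "8 * num_optimal (2 * m + 6) \<le> 2 ^ (2 * m + 6)" for m
  proof -
    have "num_optimal (2 * m + 6) \<le> 2 * num_optimal (2 * m + 5)"
    proof -
      have "2 * (m + 2) + 2 = 2 * m + 6" "2 * (m + 2) + 1 = 2 * m + 5" by simp_all
      note * = num_optimal_rec(1)[OF le_add2, of m, unfolded this]
      show ?thesis using * by linarith
    qed
    moreover have "(2::nat) ^ (2 * m + 6) = 2 * 2 ^ (2 * m + 5)" by (simp add: power_add)
    ultimately show ?thesis using odd[of m] by linarith
  qed
  have "8 * num_optimal (n + 4) \<le> 2 ^ (n + 4)"
  proof (cases "n = 0")
    case True
    then show ?thesis by (simp add: num_optimal_initial)
  next
    case False
    then have "n + 4 = 2 * ((n - 1) div 2) + 5 \<or> n + 4 = 2 * ((n - 1) div 2) + 6" by arith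
    then obtain m where "n + 4 = 2 * m + 5 \<or> n + 4 = 2 * m + 6" by blast
    then show ?thesis using odd even by metis
  qed
  then have "real (8 * num_optimal (n + 4)) \<le> real (2 ^ (n + 4))" by (rule of_nat_mono)
  then show ?thesis by (simp add: field_simps)
qed

theorem theorem1p3:
  shows "\<exists>\<alpha>::real.
    (\<lambda>n. real (num_optimal n) / 2 ^ n) \<longlonglongrightarrow> \<alpha> \<and> \<alpha> > 0 \<and>
    summable (\<lambda>n. real (num_optimal (n + 4)) / 4 ^ (n + 4)) \<and>
    \<alpha> = 1 / 16 - 2 * (\<Sum>n. real (num_optimal (n + 4)) / 4 ^ (n + 4))"
proof -
  define t where "t n = real (num_optimal (n + 4)) / 4 ^ (n + 4)" for n
  define h where "h n = real (num_optimal n) / 2 ^ n" for n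
  have t_le: "t n \<le> 1 / 128 * (1 / 2) ^ n" for n
  proof -
    have "t n = h (n + 4) * (1 / 2) ^ (n + 4)"
      by (simp add: t_def h_def power_divide flip: power_mult_distrib)
    also have "\<dots> \<le> 1 / 8 * (1 / 2) ^ (n + 4)"
      using num_optimal_le[of n] unfolding h_def by (intro mult_right_mono) auto
    also have "\<dots> = 1 / 128 * (1 / 2) ^ n" by (simp add: power_add power_divide)
    finally show ?thesis .
  qed
  have t_nonneg: "0 \<le> t n" for n by (simp add: t_def)
  have geo: "(\<lambda>n. 1 / 128 * (1 / 2) ^ n) sums (1 / 64 :: real)"
    using sums_mult[OF geometric_sums[of "1 / 2 :: real"], of "1 / 128"] by simp
  have summable: "summable t"
    by (rule summable_comparison_test'[OF sums_summable[OF geo]]) (use t_le t_nonneg in simp)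
  \<comment> \<open>This leaves \<alpha> at least \<open>1 / 32\<close>.\<close>
  have S_le: "suminf t \<le> 1 / 64"
    using suminf_le[OF t_le summable sums_summable[OF geo]] sums_unique[OF geo] by simp
  define \<alpha> where "\<alpha> = 1 / 16 - 2 * suminf t"
  have pow: "(2::real) ^ (2 * m + 5) = 32 * 4 ^ m" "(2::real) ^ (2 * m + 6) = 64 * 4 ^ m"
    "(2::real) ^ (2 * m + 7) = 128 * 4 ^ m" "(4::real) ^ (m + 4) = 256 * 4 ^ m" for m
    by (simp_all add: power_add power_mult)
  \<comment> \<open>Along odd lengths the recurrence subtracts exactly \<open>2 * t m\<close> at
    each step; the constant \<open>1 / 16\<close> is the starting value
    \<open>h 5 = 2 / 32\<close>.\<close>
  have odd_eq: "h (2 * m + 5) = 1 / 16 - 2 * (\<Sum>i<m. t i)" for m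
  proof (induction m)
    case 0
    then show ?case by (simp add: h_def num_optimal_initial)
  next
    case (Suc m)
    have "2 * (m + 2) + 3 = 2 * m + 7" "2 * (m + 2) + 1 = 2 * m + 5" "m + 2 + 2 = m + 4" by simp_all
    then have "num_optimal (2 * m + 7) + num_optimal (m + 4) = 4 * num_optimal (2 * m + 5)"
      using num_optimal_rec(2)[OF le_add2, of m] by (simp only:)
    then have "real (num_optimal (2 * m + 7)) + real (num_optimal (m + 4)) = 4 * real (num_optimal (2 * m + 5))"
      by linarith
    then have "h (2 * m + 7) = h (2 * m + 5) - 2 * t m"
      unfolding h_def t_def pow by (simp add: divide_simps)
    moreover have "2 * Suc m + 5 = 2 * m + 7" by simp
    ultimately show ?case using Suc by (simp only: sum.lessThan_Suc distrib_left diff_diff_eq)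
  qed
  \<comment> \<open>Even lengths differ from the preceding odd ones by a term of a convergent
    series, so they have the same limit.\<close>
  have even_eq: "h (2 * m + 6) = h (2 * m + 5) - 4 * t m" for m
  proof -
    have "2 * (m + 2) + 2 = 2 * m + 6" "2 * (m + 2) + 1 = 2 * m + 5" "m + 2 + 2 = m + 4" by simp_all
    then have "num_optimal (2 * m + 6) + num_optimal (m + 4) = 2 * num_optimal (2 * m + 5)"
      using num_optimal_rec(1)[OF le_add2, of m] by (simp only:)
    then have "real (num_optimal (2 * m + 6)) + real (num_optimal (m + 4)) = 2 * real (num_optimal (2 * m + 5))"
      by linarith
    then show ?thesis unfolding h_def t_def pow by (simp add: divide_simps)
  qed
  have odd_lim: "(\<lambda>m. h (2 * m + 5)) \<longlonglongrightarrow> \<alpha>"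
    unfolding odd_eq \<alpha>_def by (intro tendsto_intros summable_LIMSEQ summable)
  have "(\<lambda>m. h (2 * m + 5) - 4 * t m) \<longlonglongrightarrow> \<alpha> - 4 * 0"
    by (intro tendsto_intros odd_lim summable_LIMSEQ_zero summable)
  then have even_lim: "(\<lambda>m. h (2 * m + 6)) \<longlonglongrightarrow> \<alpha>"
    unfolding even_eq by simp
  have "(\<lambda>n. h (n + 5)) \<longlonglongrightarrow> \<alpha>"
    by (rule limseq_even_odd) (use odd_lim even_lim in \<open>simp_all add: add.commute\<close>)
  then have "h \<longlonglongrightarrow> \<alpha>" by (rule LIMSEQ_offset)
  moreover have "0 < \<alpha>" using S_le by (simp add: \<alpha>_def)
  ultimately show ?thesis
    using summable \<alpha>_def unfolding h_def[abs_def] t_def[abs_def] by blast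
qed

end
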